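(* Let $r\ge 1$, $0\le n\le N-1$, and let $\mathbb{D}\in\mathbb{R}^{M\times M}$ satisfy $\mathbb{D}+\mathbb{D}^T\le 0$. Let $\varphi_r(\lambda)=\det\mathbb{E}_{r+1}(\lambda)$ and let $\phi_{ki}(\lambda)=\det[\mathbb{E}_{r+1}(\lambda)_{k,i}]$, $k,i=1,\ldots,r+1$, be the minors of $\mathbb{E}_{r+1}(\lambda)$. Then the matrix $\varphi_r(\tau_n\mathbb{D})$ is invertible, and the solution $\mathbf{X}=(\mathbf{a}_0^T,\ldots,\mathbf{a}_r^T)^T$ of the linear system $\mathbb{A}\mathbf{X}=\mathbf{B}$ satisfies, for $i=1,\ldots,r+1$, $$\mathbf{a}_{i-1}=(-1)^r\delta_{i,r+1}\mathbf{b}_r+\sum_{j=1}^r(\zeta_j\mathbb{I}+\tau_n\mathbb{D})^{-1}\left(\sum_{k=1}^{r+1}(-1)^{i+k+1}\frac{\phi_{ki}(-\zeta_j)}{P_r'(\zeta_j)}\,\mathbf{b}_{k-1}\right),$$ where $\zeta_1,\ldots,\zeta_r\in\mathbb{C}$ are the zeros of $P_r$.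
   Context: $P_r(z)=\sum_{j=0}^r\frac{(2r-j)!\,r!}{(2r)!\,j!\,(r-j)!}z^j$ is the numerator of the $[r/r]$ Padé approximation of $e^z$; its zeros are simple and satisfy $\mathrm{Re}(\zeta_j)\le-2$. For $\lambda$ a scalar variable put $a_k=\frac{\lambda}{2}\frac{1}{2k-1}$, $b_k=-\frac{\lambda}{2}\frac{1}{2k+3}$, $c_k=(-1)^{k+1}$. $\mathbb{E}_{r+1}(\lambda)$ is the $(r+1)\times(r+1)$ matrix with entries: $(k,k)$-entry $a_k$ and $(k,k+1)$-entry $-1$ for $1\le k\le r$; $(k,k+2)$-entry $b_k$ for $1\le k\le r-2$; last row $(c_1,\ldots,c_{r+1})$; all other entries $0$. For a matrix $\mathbb{X}$, $\mathbb{X}_{i,j}$ denotes $\mathbb{X}$ with row $i$ and column $j$ removed. For a polynomial $p(\lambda)=\sum_i p_i\lambda^i$ and a square matrix $\mathbb{X}$, $p(\mathbb{X})=\sum_i p_i\mathbb{X}^i$. Setting: $0=t_0<\cdots<t_N=T$ is a partition, $I_n=(t_n,t_{n+1})$, $\tau_n=t_{n+1}-t_n$. $\mathbb{A}=\mathbb{E}_{r+1}(\tau_n\mathbb{D})$ is the $(r+1)\times(r+1)$ block matrix with $M\times M$ blocks obtained by replacing each entry $e_{ij}(\lambda)$ of $\mathbb{E}_{r+1}(\lambda)$ by the matrix $e_{ij}(\tau_n\mathbb{D})$ (constants become multiples of the identity $\mathbb{I}\in\mathbb{R}^{M\times M}$). $\mathbf{B}=(\mathbf{b}_0^T,\ldots,\mathbf{b}_r^T)^T$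 with $\mathbf{b}_{k-1}=-\frac{\tau_n}{2}\left(\frac{\mathbf{R}_{k-1}}{2k-1}-\frac{\mathbf{R}_{k+1}}{2k+3}\right)$ for $1\le k\le r-2$; $\mathbf{b}_{k-1}=-\frac{\tau_n}{2}\frac{\mathbf{R}_{k-1}}{2k-1}$ for $k=r-1,r$ (with $k\ge1$); $\mathbf{b}_r=\mathbf{Y}_r^n$, where $\mathbf{R}_0,\ldots,\mathbf{R}_{r-1},\mathbf{Y}_r^n\in\mathbb{R}^M$ are given vectors. (The system $\mathbb{A}\mathbf{X}=\mathbf{B}$, which is uniquely solvable, determines the coefficients of $\mathbf{Y}_r=\sum_{j=0}^r\mathbf{a}_j\widetilde L_j$ on $I_n$ in the mapped Legendre basis for the continuous time Galerkin method $\mathbf{Y}_r'=\mathbb{D}\mathcal{P}_{r-1}\mathbf{Y}_r+\mathcal{P}_{r-1}\mathbf{R}$, $\mathbf{Y}_r(t_n)=\mathbf{Y}_r^n$, where $\mathcal{P}_{r-1}\mathbf{R}=\sum_{j=0}^{r-1}\mathbf{R}_j\widetilde L_j$.) $\delta_{i,j}$ is the Kronecker delta. *)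

theory Defs
  imports
    Complex_Main
    "Jordan_Normal_Form.Determinant"
    "Jordan_Normal_Form.Gauss_Jordan_Elimination"
begin

definition pade_num :: "nat \<Rightarrow> 'a::field_char_0 poly" where
  "pade_num r =
    (\<Sum>j\<le>r. monom (fact (2 * r - j) * fact r / (fact (2 * r) * fact j * fact (r - j))) j)"

text \<open>The entries a_k, b_k, c_k are polynomials in the scalar variable lambda; k is one-based.\<close>

definition a_entry :: "nat \<Rightarrow> 'a::field_char_0 poly" where
  "a_entry k = monom (1 / 2 * (1 / (2 * of_nat k - 1))) 1"

definition b_entry :: "nat \<Rightarrow> 'a::field_char_0 poly" where
  "b_entry k = monom (- (1 / 2) * (1 / (2 * of_nat k + 3))) 1"

definition c_entry :: "nat \<Rightarrow> 'a::field_char_0 poly" where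
  "c_entry k = (- 1) ^ (k + 1)"

text \<open>\<open>E_mat r\<close> has size r + 1. Matrix indices of the library start at 0, so the
  one-based row and column are k = p + 1 and l = q + 1.\<close>

definition E_mat :: "nat \<Rightarrow> 'a::field_char_0 poly mat" where
  "E_mat r = mat (r + 1) (r + 1) (\<lambda>(p, q).
     let k = p + 1; l = q + 1 in
     if k = r + 1 then c_entry l
     else if l = k then a_entry k
     else if l = k + 1 then - 1
     else if l = k + 2 \<and> k + 2 \<le> r then b_entry k
     else 0)"

definition phi :: "nat \<Rightarrow> 'a::field_char_0 poly" where
  "phi r = det (E_mat r)"

text \<open>Here k and i are one-based.\<close>

definition phi_minor :: "nat \<Rightarrow> nat \<Rightarrow> nat \<Rightarrow> 'a::field_char_0 poly" where
  "phi_minor r k i = det (mat_delete (E_mat r) (k - 1) (i - 1))"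

definition poly_mat :: "'a::comm_ring_1 poly \<Rightarrow> 'a mat \<Rightarrow> 'a mat" where
  "poly_mat p X = mat (dim_row X) (dim_row X)
     (\<lambda>(s, u). \<Sum>i\<le>degree p. coeff p i * (X ^\<^sub>m i) $$ (s, u))"

text \<open>Block objects with blocks of size M are stored flat: entry s of block p (both zero-based)
  has index p * M + s.\<close>

definition poly_block_mat :: "'a::comm_ring_1 poly mat \<Rightarrow> 'a mat \<Rightarrow> 'a mat" where
  "poly_block_mat E X = (let M = dim_row X in
     mat (dim_row E * M) (dim_col E * M)
       (\<lambda>(p, q). poly_mat (E $$ (p div M, q div M)) X $$ (p mod M, q mod M)))"

definition block_vec :: "nat \<Rightarrow> nat \<Rightarrow> (nat \<Rightarrow> 'a vec) \<Rightarrow> 'a vec" where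
  "block_vec m M f = vec (m * M) (\<lambda>p. f (p div M) $ (p mod M))"

definition vec_block :: "nat \<Rightarrow> 'a vec \<Rightarrow> nat \<Rightarrow> 'a vec" where
  "vec_block M X j = vec M (\<lambda>s. X $ (j * M + s))"

text \<open>\<open>rhs_block r \<tau> R Y m\<close> is the block b_m for m = 0, ..., r, and k = m + 1.\<close>

definition rhs_block :: "nat \<Rightarrow> real \<Rightarrow> (nat \<Rightarrow> real vec) \<Rightarrow> real vec \<Rightarrow> nat \<Rightarrow> real vec" where
  "rhs_block r \<tau> R Y m = (let k = m + 1 in
     if k = r + 1 then Y
     else if k + 2 \<le> r then
       (- (\<tau> / 2)) \<cdot>\<^sub>v ((1 / (2 * real k - 1)) \<cdot>\<^sub>v R (k - 1) - (1 / (2 * real k + 3)) \<cdot>\<^sub>v R (k + 1))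
     else (- (\<tau> / 2)) \<cdot>\<^sub>v ((1 / (2 * real k - 1)) \<cdot>\<^sub>v R (k - 1)))"

definition neg_semidefinite :: "real mat \<Rightarrow> bool" where
  "neg_semidefinite S \<longleftrightarrow> square_mat S \<and> transpose_mat S = S \<and>
     (\<forall>x \<in> carrier_vec (dim_row S). x \<bullet> (S *\<^sub>v x) \<le> 0)"

text \<open>The library's \<open>mat_inverse\<close> returns an option; this is the inverse of an invertible matrix.\<close>

definition mat_inv :: "'a::field mat \<Rightarrow> 'a mat" where
  "mat_inv X = the (mat_inverse X)"

end

theory Submission
  imports Defs "Jordan_Normal_Form.Char_Poly"
    "HOL-Computational_Algebra.Fundamental_Theorem_Algebra"
begin

text \<open>Since \<open>b_k = - a_(k+2)\<close>, the first r rows of \<open>E_mat r\<close> form a Bessel-type recurrence that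
  continuants solve explicitly; the last row telescopes on that solution, which yields
  \<open>phi r (x) = P_r (- x)\<close> by the three-term recurrence of the Pade numerators. The same recurrence
  shows that \<open>P_(r+1) / (z P_r)\<close> has positive real part on the closed right half-plane, so all zeros
  of \<open>P_r\<close> have negative real part, and the Kummer equation of \<open>P_r\<close> shows that they are simple.
  As the quadratic form of \<open>\<tau> D\<close> is nonpositive, every \<open>\<zeta>_j + \<tau> D\<close>, hence \<open>phi r (\<tau> D)\<close>, is injective.
  Applying the adjugate of \<open>E_mat r\<close> blockwise gives Cramer's rule for the block system, and the
  formula is the partial fraction expansion of \<open>phi_minor r k i / phi r\<close>; this fraction is proper
  except for k = i = r + 1, where its value at infinity is \<open>(- 1) ^ r\<close>.\<close>

section \<open>Zeros of the Pade numerators\<close>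

text \<open>Two obstacles shape the argument. The matrix is real while the zeros are complex. The
  polynomial objects are instances of one polymorphic definition over either field and have rational
  coefficients, so the formula is proved for a complex matrix \<open>Q\<close> and carried over
  along \<open>of_real\<close>. Moreover, the resolvents are rational functions of a matrix. They
  are never expanded: both sides of the formula are compared after applying \<open>phi r\<close> at
  \<open>Q\<close>, which turns each resolvent into the polynomial
  \<open>phi r div [:\<zeta> j, 1:]\<close> at \<open>Q\<close>, and the injectivity of
  \<open>phi r\<close> at \<open>Q\<close> cancels it afterwards. Avoiding division is also the
  reason for the extra factor of the variable in \<open>lommel_vec\<close>. The link between the
  matrix and the Pade numerators is the product of \<open>a_entry (r + 1)\<close> and
  \<open>a_entry (r + 2)\<close>: it is x^2 / (4 (2r + 1) (2r + 3)), exactly the coefficient of the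
  three-term recurrence, and being even in x it is unaffected by the substitution of -x.\<close>

lemma coeff_pade_num:
  "coeff (pade_num r) j =
    (if j \<le> r then fact (2 * r - j) * fact r / (fact (2 * r) * fact j * fact (r - j)) else 0)"
  by (auto simp: pade_num_def coeff_sum coeff_monom)

lemma degree_pade_num: "degree (pade_num r) = r"
proof (rule antisym)
  show "degree (pade_num r) \<le> r"
    by (rule degree_le) (simp add: coeff_pade_num)
  show "r \<le> degree (pade_num r)"
    by (rule le_degree) (simp add: coeff_pade_num)
qed

lemma pade_num_0: "pade_num 0 = 1"
  by (simp add: pade_num_def monom_0 one_pCons)

lemma poly_pade_num_0: "poly (pade_num r) 0 = 1"
  by (simp add: poly_0_coeff_0 coeff_pade_num)

lemma pade_num_1: "pade_num (Suc 0) = [:1, 1 / 2:]"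
  by (rule poly_eqI) (auto simp: coeff_pade_num coeff_pCons numeral_2_eq_2 split: nat.splits)

lemma of_nat_Suc_double_nonzero: "(2 * of_nat k + 1 :: 'a::field_char_0) \<noteq> 0"
  by (metis of_nat_neq_0 of_nat_Suc of_nat_mult of_nat_numeral add.commute)

text \<open>These are the coefficient ratios of the hypergeometric series 1F1(-r; -2r; z), cut off
  at degree r. The cross-multiplied form stays valid at j = r, where the factor r - j vanishes, and
  beyond.\<close>

lemma coeff_pade_num_Suc:
  "of_nat (Suc j) * (2 * of_nat r - of_nat j) * coeff (pade_num r) (Suc j) =
    (of_nat r - of_nat j) * (coeff (pade_num r) j :: 'a::field_char_0)"
proof -
  consider "j < r" | "j = r" | "j > r" by linarith
  then show ?thesis
  proof cases
    case 1
    then obtain m where m: "r = Suc (j + m)" using less_imp_Suc_add by blast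
    define N where "N = j + 2 * m + 1"
    have sh: "2 * r - j = Suc N" "2 * r - Suc j = N" "r - j = Suc m" "r - Suc j = m"
      "(2 * of_nat r - of_nat j :: 'a) = of_nat (Suc N)" "(of_nat r - of_nat j :: 'a) = of_nat (Suc m)"
      by (simp_all add: m N_def algebra_simps)
    have nz: "of_nat (Suc k) \<noteq> (0 :: 'a)" for k by (rule of_nat_neq_0)
    show ?thesis
      using 1 nz[of j] nz[of m] nz[of N] unfolding coeff_pade_num sh fact_Suc
      by (simp del: of_nat_Suc)
  qed (simp_all add: coeff_pade_num)
qed

lemma pade_num_rec:
  "pade_num (Suc (Suc r)) = pade_num (Suc r) +
     monom (1 / (4 * (2 * of_nat r + 1) * (2 * of_nat r + 3))) 2 * (pade_num r :: 'a::field_char_0 poly)"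
proof (rule poly_eqI)
  fix j
  let ?c = "\<lambda>r j. coeff (pade_num r :: 'a poly) j"
  let ?d = "1 / (4 * (2 * of_nat r + 1) * (2 * of_nat r + 3)) :: 'a"
  have nz: "(2 * of_nat k + 1 :: 'a) \<noteq> 0" "(2 * of_nat k + 3 :: 'a) \<noteq> 0"
    "(of_nat k + 1 :: 'a) \<noteq> 0" "(of_nat k + 2 :: 'a) \<noteq> 0" for k
    using of_nat_Suc_double_nonzero[of k, where 'a='a] of_nat_Suc_double_nonzero[of "Suc k", where 'a='a]
      of_nat_neq_0[of k, where 'a='a] of_nat_neq_0[of "Suc k", where 'a='a]
    by (simp_all add: algebra_simps)
  have "?c (Suc (Suc r)) j = ?c (Suc r) j + (if j < 2 then 0 else ?d * ?c r (j - 2))"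
  proof -
    \<comment> \<open>For 2 \<le> j \<le> r + 1 all three coefficients are given by the factorial
      formula; the parameters i = j - 2 and m = r + 1 - j rid the factorials of truncated
      subtraction. At the remaining indices at least one of the terms vanishes.\<close>
    consider "j = 0" | "j = 1" | i m where "j = i + 2" "r = i + 1 + m"
      | "j = Suc (Suc r)" | "j > Suc (Suc r)"
    proof -
      have "j = (j - 2) + 2 \<and> r = (j - 2) + 1 + (r + 1 - j)" if "2 \<le> j" "j \<le> Suc r"
        using that by arith
      then show ?thesis using that
        by (metis One_nat_def le_less_linear less_2_cases not_less_eq_eq antisym)
    qed
    then show ?thesis
    proof cases
      case 1
      then show ?thesis by (simp add: coeff_pade_num del: fact_Suc mult_Suc_right)
    next
      case 2
      have c1: "?c (Suc k) 1 = 1 / 2" for k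
      proof -
        have "of_nat (Suc k) * (2 * ?c (Suc k) 1) = of_nat (Suc k) * (?c (Suc k) 0)"
          using coeff_pade_num_Suc[of 0 "Suc k", where 'a='a] by (simp add: ac_simps del: of_nat_Suc) simp
        then have "2 * ?c (Suc k) 1 = ?c (Suc k) 0"
          using of_nat_neq_0[of k, where 'a='a] by (metis mult_left_cancel)
        then show ?thesis
          using poly_pade_num_0[of "Suc k", where 'a='a]
          by (simp add: poly_0_coeff_0 eq_divide_eq mult.commute)
      qed
      show ?thesis unfolding 2 c1 by simp
    next
      case (3 i m)
      define x where "x = (of_nat i :: 'a)"
      define y where "y = (of_nat m :: 'a)"
      define u where "u = (of_nat r :: 'a)"
      define N where "N = i + 2 * m + 2"
      have xy: "u = x + y + 1" "of_nat N = x + 2 * y + 2"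
        using 3 by (simp_all add: x_def y_def N_def u_def algebra_simps)
      have sh: "2 * Suc (Suc r) - j = Suc (Suc N)" "2 * Suc r - j = N" "2 * r - i = N"
        "Suc (Suc r) - j = Suc m" "Suc r - j = m" "r - i = Suc m" "j = Suc (Suc i)"
        "2 * Suc (Suc r) = Suc (Suc (Suc (Suc (2 * r))))" "2 * Suc r = Suc (Suc (2 * r))"
        "i \<le> r" "j - 2 = i"
        using 3 by (simp_all add: N_def)
      have le: "j \<le> Suc (Suc r)" "j \<le> Suc r" "\<not> j < 2" using 3 by simp_all
      \<comment> \<open>Factorials and linear factors are abstracted to letters. Over the common
        denominator the recurrence reduces to the quadratic identity
        \<open>N4 * N3 = 2 * B * w + p * q\<close>, which \<open>main\<close> verifies from u = x +
        y + 1.\<close>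
      have aux: "N4 * (N3 * F) * (D * (C * H)) /
          (2 * D * (B * (2 * C * (A * G))) * (q * (p * I)) * (w * K)) =
          F * (C * H) / (2 * C * (A * G) * (q * (p * I)) * K) + 1 / (4 * A * B) * (F * H / (G * I * (w * K)))"
        if "N4 * N3 = 2 * B * w + p * q"
          "A \<noteq> 0" "B \<noteq> 0" "C \<noteq> 0" "D \<noteq> 0" "p \<noteq> 0" "q \<noteq> 0" "w \<noteq> 0" "G \<noteq> 0" "I \<noteq> 0" "K \<noteq> 0"
        for A B C D p q w F G H I K N3 N4 :: 'a
      proof -
        have "N4 * (N3 * F) * (D * (C * H)) /
          (2 * D * (B * (2 * C * (A * G))) * (q * (p * I)) * (w * K)) =
          (N4 * N3) * (F * H) / (4 * A * B * p * q * w * G * I * K)"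
          using that(2-) by (simp add: divide_simps)
        also have "\<dots> = F * (C * H) / (2 * C * (A * G) * (q * (p * I)) * K)
            + 1 / (4 * A * B) * (F * H / (G * I * (w * K)))"
          unfolding that(1) using that(2-) by (simp add: divide_simps) (simp add: algebra_simps)?
        finally show ?thesis .
      qed
      have main: "(x + 2 * y + 4) * ((x + 2 * y + 3) * F) * ((u + 2) * ((u + 1) * H)) /
          (2 * (u + 2) * ((2 * u + 3) * (2 * (u + 1) * ((2 * u + 1) * G)))
            * ((x + 2) * ((x + 1) * I)) * ((y + 1) * K)) =
          F * ((u + 1) * H) / (2 * (u + 1) * ((2 * u + 1) * G) * ((x + 2) * ((x + 1) * I)) * K)
          + 1 / (4 * (2 * u + 1) * (2 * u + 3)) * (F * H / (G * I * ((y + 1) * K)))"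
        if "F \<noteq> 0" "G \<noteq> 0" "H \<noteq> 0" "I \<noteq> 0" "K \<noteq> 0" for F G H I K :: 'a
      proof -
        have "2 * u + 1 \<noteq> 0" "2 * u + 3 \<noteq> 0" "u + 1 \<noteq> 0" "u + 2 \<noteq> 0" "x + 1 \<noteq> 0" "x + 2 \<noteq> 0"
          "y + 1 \<noteq> 0"
          using nz unfolding u_def x_def y_def by blast+
        moreover have "(x + 2 * y + 4) * (x + 2 * y + 3) =
            2 * (2 * u + 3) * (y + 1) + (x + 1) * (x + 2)"
          unfolding xy by (simp add: algebra_simps)
        ultimately show ?thesis using that by (intro aux)
      qed
      have fs: "(fact (Suc (Suc N)) :: 'a) = (x + 2 * y + 4) * ((x + 2 * y + 3) * fact N)"
        "(fact (Suc (Suc r)) :: 'a) = (u + 2) * ((u + 1) * fact r)"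
        "(fact (Suc r) :: 'a) = (u + 1) * fact r"
        "(fact (Suc (Suc (Suc (Suc (2 * r)))))) =
            2 * (u + 2) * ((2 * u + 3) * (2 * (u + 1) * ((2 * u + 1) * (fact (2 * r) :: 'a))))"
        "(fact (Suc (Suc (2 * r)))) = 2 * (u + 1) * ((2 * u + 1) * (fact (2 * r) :: 'a))"
        "(fact (Suc (Suc i)) :: 'a) = (x + 2) * ((x + 1) * fact i)"
        "(fact (Suc m) :: 'a) = (y + 1) * fact m"
        by (simp_all add: xy(2) u_def[symmetric] x_def[symmetric] y_def[symmetric] algebra_simps)
      show ?thesis
        unfolding coeff_pade_num if_P[OF le(1)] if_P[OF le(2)] if_not_P[OF le(3)] sh(11) if_P[OF sh(10)]
          sh(1-6) unfolding sh(7-9) fs unfolding u_def[symmetric]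
        by (rule main) simp_all
    next
      case 4
      define u where "u = (of_nat r :: 'a)"
      have nzu: "2 * u + 1 \<noteq> 0" "2 * u + 3 \<noteq> 0" "u + 1 \<noteq> 0" "u + 2 \<noteq> 0"
        using nz unfolding u_def by blast+
      have sh: "2 * Suc (Suc r) - j = Suc (Suc r)" "j - 2 = r" "2 * r - r = r"
        "2 * Suc (Suc r) = Suc (Suc (Suc (Suc (2 * r))))" using 4 by simp_all
      have fs:
        "(fact (Suc (Suc r)) :: 'a) = (u + 2) * ((u + 1) * fact r)"
        "(fact (Suc (Suc (Suc (Suc (2 * r)))))) =
            2 * (u + 2) * ((2 * u + 3) * (2 * (u + 1) * ((2 * u + 1) * (fact (2 * r) :: 'a))))"
        by (simp_all add: u_def[symmetric] algebra_simps)
      have aux: "D * (C * H) / (2 * D * (B * (2 * C * (A * G)))) = 1 / (4 * A * B) * (H / G)"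
        if "A \<noteq> 0" "B \<noteq> 0" "C \<noteq> 0" "D \<noteq> 0" "G \<noteq> 0" for A B C D G H :: 'a
        using that by (simp add: divide_simps)
      have "?c (Suc (Suc r)) j = fact (Suc (Suc r)) / fact (2 * Suc (Suc r))"
        unfolding coeff_pade_num sh(1) using 4 by simp
      also have "\<dots> = ?d * (fact r / fact (2 * r))"
        unfolding sh(4) fs u_def[symmetric] by (rule aux) (use nzu in simp_all)
      also have "fact r / fact (2 * r) = ?c r (j - 2)"
        by (simp add: coeff_pade_num sh(2,3))
      finally show ?thesis using 4 by (simp add: coeff_pade_num)
    next
      case 5
      then show ?thesis by (auto simp: coeff_pade_num)
    qed
  qed
  then show "?c (Suc (Suc r)) j = coeff (pade_num (Suc r) + monom ?d 2 * pade_num r) j"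
    by (simp add: coeff_monom_mult)
qed

text \<open>This is Kummer's equation with parameters -r and -2r; the comparison of coefficients is
  exactly \<open>coeff_pade_num_Suc\<close>.\<close>

lemma pade_num_ode:
  "[:0, 1:] * pderiv (pderiv (pade_num r)) =
    [:2 * of_nat r, 1:] * pderiv (pade_num r) - smult (of_nat r) (pade_num r :: 'a::field_char_0 poly)"
proof (rule poly_eqI)
  fix j
  show "coeff ([:0, 1:] * pderiv (pderiv (pade_num r))) j =
    coeff ([:2 * of_nat r, 1:] * pderiv (pade_num r) - smult (of_nat r) (pade_num r :: 'a poly)) j"
    using coeff_pade_num_Suc[of j r, where 'a='a]
    by (cases j) (auto simp: coeff_pderiv algebra_simps)
qed

text \<open>The quotient \<open>w_r = P_r / (z P_(r-1))\<close> satisfies \<open>w_(r+1) = 1 / z + c / w_r\<close> with \<open>c > 0\<close>, which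
  preserves positivity of the real part; the statement avoids the division.\<close>

lemma Re_pade_num_pos:
  assumes "Re z \<ge> 0" "z \<noteq> 0"
  shows "Re (poly (pade_num (Suc r)) z * cnj (z * poly (pade_num r) z)) > 0"
proof (induction r)
  case 0
  have "(Re z)\<^sup>2 + (Im z)\<^sup>2 > 0"
    using assms(2) by (simp add: complex_eq_iff sum_power2_gt_zero_iff)
  then show ?case
    using assms(1) by (simp add: pade_num_0 pade_num_1 algebra_simps power2_eq_square add_nonneg_pos)
next
  case (Suc r)
  let ?f = "\<lambda>r. poly (pade_num r) z"
  define c :: real where "c = 1 / (4 * (2 * of_nat r + 1) * (2 * of_nat r + 3))"
  have c: "c > 0" by (simp add: c_def add_pos_nonneg)
  have rec: "?f (Suc (Suc r)) = ?f (Suc r) + of_real c * z\<^sup>2 * ?f r"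
    by (simp add: pade_num_rec poly_monom c_def)
  \<comment> \<open>Since z^2 times the conjugate of z is z |z|^2, the second summand is a positive
    multiple of the conjugate of the quantity in the induction hypothesis, hence has positive real
    part; the first one contributes a nonnegative multiple of Re z.\<close>
  have "?f (Suc (Suc r)) * cnj (z * ?f (Suc r)) =
      of_real ((cmod (?f (Suc r)))\<^sup>2) * cnj z +
      of_real (c * (cmod z)\<^sup>2) * cnj (?f (Suc r) * cnj (z * ?f r))"
    unfolding rec of_real_mult complex_norm_square by (simp add: algebra_simps power2_eq_square)
  also have "Re \<dots> = (cmod (?f (Suc r)))\<^sup>2 * Re z +
      c * (cmod z)\<^sup>2 * Re (?f (Suc r) * cnj (z * ?f r))"
    by (simp del: complex_cnj_mult)
  finally have eq: "Re (?f (Suc (Suc r)) * cnj (z * ?f (Suc r))) = \<dots>" .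
  show ?case unfolding eq
    using Suc.IH c assms by (intro add_nonneg_pos mult_nonneg_nonneg mult_pos_pos) auto
qed

lemma Re_pade_num_zero:
  assumes "poly (pade_num r) z = 0"
  shows "Re z < 0"
proof (cases r)
  case 0
  then show ?thesis using assms by (simp add: pade_num_0)
next
  case (Suc k)
  have "z \<noteq> 0" using assms poly_pade_num_0[of r, where 'a=complex] by auto
  then show ?thesis using Re_pade_num_pos[of z k] assms Suc by force
qed

text \<open>At a multiple zero the two sides of the differential equation would have different orders.\<close>

lemma pade_num_simple_zero:
  fixes z :: complex
  assumes "poly (pade_num r) z = 0"
  shows "poly (pderiv (pade_num r)) z \<noteq> 0"
proof
  let ?P = "pade_num r :: complex poly"
  assume z': "poly (pderiv ?P) z = 0"
  have z: "z \<noteq> 0" using assms poly_pade_num_0[of r, where 'a=complex] by auto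
  have P0: "?P \<noteq> 0" using poly_pade_num_0[of r, where 'a=complex] by auto
  have r: "r \<noteq> 0" using assms by (metis pade_num_0 poly_1 zero_neq_one)
  then have P1: "pderiv ?P \<noteq> 0" by (simp add: pderiv_eq_0_iff degree_pade_num)
  define m where "m = order z (pderiv (pderiv ?P))"
  have o1: "order z (pderiv ?P) = Suc m"
    unfolding m_def by (rule order_pderiv[OF P1 z'])
  have o0: "order z ?P = Suc (Suc m)"
    using order_pderiv[OF P0 assms] o1 by simp
  have P2: "pderiv (pderiv ?P) \<noteq> 0"
  proof
    assume "pderiv (pderiv ?P) = 0"
    then have "degree (pderiv ?P) = 0" by (simp add: pderiv_eq_0_iff)
    then obtain a where "pderiv ?P = [:a:]" by (rule degree_eq_zeroE)
    then show False using z' P1 by simp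
  qed
  \<comment> \<open>The right-hand side of the equation has order at least m + 1 at z. The left-hand
    side has order exactly m, because the factor given by the variable does not vanish at z.\<close>
  have "[:-z, 1:] ^ Suc m dvd pderiv ?P" "[:-z, 1:] ^ Suc m dvd ?P"
    using o1 o0 P0 P1 by (simp_all only: order_divides) simp_all
  then have "[:-z, 1:] ^ Suc m dvd [:0, 1:] * pderiv (pderiv ?P)"
    unfolding pade_num_ode by (intro dvd_diff dvd_mult dvd_smult)
  then have "Suc m \<le> order z ([:0, 1:] * pderiv (pderiv ?P))"
    using P2 by (subst (asm) order_divides) auto
  also have "\<dots> = order z [:0, 1:] + m"
    using P2 unfolding m_def by (intro order_mult) simp
  also have "order z [:0, 1:] = 0"
    using z by (intro order_0I) simp
  finally show False by simp
qed

text \<open>Simple zeros make the count equal to the degree. This turns a listing of the zero set by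
  r indices into a listing without repetition, since a map from r indices onto r points is
  injective.\<close>

lemma card_pade_num_zeros: "card {z :: complex. poly (pade_num r) z = 0} = r"
proof -
  let ?P = "pade_num r :: complex poly"
  have "rsquarefree ?P"
    unfolding rsquarefree_roots using pade_num_simple_zero by blast
  from complex_poly_decompose_rsquarefree[OF this]
  have "degree ?P = degree (smult (lead_coeff ?P) (\<Prod>z|poly ?P z = 0. [:-z, 1:]))"
    by simp
  also have "\<dots> = card {z. poly ?P z = 0}"
    using poly_pade_num_0[of r, where 'a=complex]
    by (subst degree_smult_eq, subst degree_prod_eq_sum_degree) auto
  finally show ?thesis by (simp add: degree_pade_num)
qed

section \<open>The determinant of the Galerkin matrix\<close>

text \<open>With \<open>a_j\<close> the diagonal entries, \<open>lommel r k\<close> is \<open>a_1 \<cdots> a_r\<close> times the continuant of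
  \<open>1 / a_(k+1), \<dots>, 1 / a_r\<close>, which obeys a three-term recurrence at either end.\<close>

fun lommel :: "nat \<Rightarrow> nat \<Rightarrow> 'a::field_char_0 poly" where
  "lommel 0 k = (if k = 0 then 1 else 0)"
| "lommel (Suc 0) k = (if k = 0 then 1 else if k = 1 then a_entry 1 else 0)"
| "lommel (Suc (Suc r)) k =
    (if k = Suc (Suc r) then a_entry (Suc (Suc r)) * lommel (Suc r) (Suc r)
     else lommel (Suc r) k + a_entry (Suc (Suc r)) * a_entry (Suc r) * lommel r k)"

lemma lommel_above: "r < k \<Longrightarrow> lommel r k = 0"
  by (induction r k rule: lommel.induct) auto

lemma lommel_diag: "lommel r r = (\<Prod>k=1..r. a_entry k)"
proof (induction r)
  case (Suc r)
  then show ?case by (cases r) (auto simp: ac_simps)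
qed simp

text \<open>The definition of \<open>lommel\<close> recurs at the upper end of the continuant, the
  rows of \<open>E_mat\<close> at the lower end. Away from the diagonal the upper recurrence has a
  coefficient independent of k, so the lower relation is inherited from the two preceding values of
  r; only indices next to the diagonal need a direct computation.\<close>

lemma lommel_rec:
  "k < Suc r \<Longrightarrow> a_entry (Suc k) * lommel (Suc r) k =
    lommel (Suc r) (Suc k) + a_entry (Suc k) * (lommel (Suc r) (Suc (Suc k)) :: 'a::field_char_0 poly)"
proof (induction r rule: less_induct)
  case (less r)
  consider "k = r" | "r = Suc k" | "Suc (Suc k) \<le> r"
    using less.prems by linarith
  then show ?case
  proof cases
    case 1
    then show ?thesis by (cases r) (simp_all add: lommel_above)
  next
    case 2
    then show ?thesis by (cases k) (simp_all add: lommel_above algebra_simps)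
  next
    case 3
    then obtain m where 3: "r = Suc (Suc m)" "k \<le> m"
      by (metis Suc_le_D Suc_le_mono)
    have "a_entry (Suc k) * lommel (Suc (Suc m)) k =
        lommel (Suc (Suc m)) (Suc k) + a_entry (Suc k) * (lommel (Suc (Suc m)) (Suc (Suc k)) :: 'a poly)"
      "a_entry (Suc k) * lommel (Suc m) k =
        lommel (Suc m) (Suc k) + a_entry (Suc k) * (lommel (Suc m) (Suc (Suc k)) :: 'a poly)"
      using less.IH[of "Suc m"] less.IH[of m] 3 by (simp_all del: lommel.simps)
    note IH = this
    define d :: "'a poly" where "d = a_entry (Suc (Suc (Suc m))) * a_entry (Suc (Suc m))"
    have step: "lommel (Suc r) l = lommel (Suc (Suc m)) l + d * lommel (Suc m) l"
      if "l \<le> Suc (Suc k)" for l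
      using that 3 unfolding d_def by (simp only: lommel.simps) simp
    have "a_entry (Suc k) * lommel (Suc r) k =
        a_entry (Suc k) * lommel (Suc (Suc m)) k + d * (a_entry (Suc k) * lommel (Suc m) k)"
      by (simp add: step algebra_simps del: lommel.simps)
    then show ?thesis unfolding IH by (simp add: step algebra_simps del: lommel.simps)
  qed
qed

lemma two_of_nat_diff_one_nonzero: "k \<noteq> 0 \<Longrightarrow> (2 * of_nat k - 1 :: 'a::field_char_0) \<noteq> 0"
proof
  assume "(2 * of_nat k - 1 :: 'a) = 0"
  then have "(of_nat (2 * k) :: 'a) = of_nat 1" by simp
  then have "2 * k = 1" by (rule of_nat_eq_iff[THEN iffD1])
  then show False by presburger
qed

lemma a_entry_scaled: "k \<noteq> 0 \<Longrightarrow> [:2 * (2 * of_nat k - 1):] * a_entry k = [:0, 1:]"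
  using two_of_nat_diff_one_nonzero[of k, where 'a='a]
  by (simp add: a_entry_def smult_monom monom_Suc monom_0)

lemma a_entry_mult_scaled:
  "k \<noteq> 0 \<Longrightarrow> a_entry k * ([:2 * (2 * of_nat k - 1):] * p) = [:0, 1:] * p"
  by (simp only: a_entry_scaled[symmetric] ac_simps)

lemma b_entry_eq: "b_entry k = - a_entry (k + 2)"
  by (simp add: a_entry_def b_entry_def minus_monom algebra_simps)

lemma a_entry_nonzero: "k \<noteq> 0 \<Longrightarrow> a_entry k \<noteq> 0"
  using two_of_nat_diff_one_nonzero[of k] by (simp add: a_entry_def)

lemma lommel_diag_nonzero: "lommel r r \<noteq> 0"
  by (simp add: lommel_diag a_entry_nonzero)

lemma sum_alternating_differences:
  "(\<Sum>k\<in>{1..m}. (-1) ^ (k + 1) * (f (k - 1) - f (k + 1))) =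
     f 0 - f 1 + (-1) ^ (m + 1) * (f m - f (m + 1))"
  for f :: "nat \<Rightarrow> 'a::comm_ring_1"
  by (induction m) (simp_all add: algebra_simps)

text \<open>The last column of the adjugate of \<open>E_mat r\<close>, multiplied by the variable.\<close>

definition lommel_vec :: "nat \<Rightarrow> 'a::field_char_0 poly vec" where
  "lommel_vec r = vec (r + 1) (\<lambda>p. if p = r then [:0, 1:] * lommel r r
     else [:2 * (2 * of_nat (p + 1) - 1):] * lommel r (p + 1))"

lemma E_mat_carrier: "E_mat r \<in> carrier_mat (r + 1) (r + 1)"
  by (simp add: E_mat_def)

text \<open>The lower recurrence times 2 (2k - 1), which turns \<open>a_entry k\<close> into the
  variable. In this form all but the last entry of \<open>lommel_vec\<close> are differences across
  an index gap of two, so that the alternating last row telescopes.\<close>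

lemma scaled_lommel:
  assumes "1 \<le> k" "k \<le> r"
  shows "[:2 * (2 * of_nat k - 1):] * lommel r k =
    [:0, 1:] * (lommel r (k - 1) - lommel r (k + 1) :: 'a::field_char_0 poly)"
proof -
  obtain l q where l: "k = Suc l" "r = Suc q" using assms by (metis Suc_le_D One_nat_def le_trans)
  have eq: "lommel r k = a_entry k * (lommel r (k - 1) - lommel r (k + 1) :: 'a poly)"
    using lommel_rec[of l q, where 'a='a] assms l by (simp del: lommel.simps add: algebra_simps)
  have "[:2 * (2 * of_nat k - 1):] * (a_entry k * p) = [:0, 1:] * p" for p :: "'a poly"
    using a_entry_mult_scaled[of k p] assms by (simp only: mult.left_commute)
  then show ?thesis by (subst eq)
qed

text \<open>By \<open>b_entry_eq\<close>, row k < r + 1 is a_k v_k - v_(k+1) - a_(k+2) v_(k+2). The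
  scaling of v gives a_k v_k = x lommel_k, and \<open>scaled_lommel\<close> writes the middle term
  as x (lommel_k - lommel_(k+2)), so everything cancels.\<close>

lemma E_mat_lommel_vec:
  assumes "r \<noteq> 0"
  shows "E_mat r *\<^sub>v lommel_vec r =
    vec (r + 1) (\<lambda>p. if p = r then [:0, 1:] * (lommel r 0 - lommel r 1 :: 'a::field_char_0 poly) else 0)"
    (is "?l = ?r")
proof (rule eq_vecI)
  let ?v = "lommel_vec r :: 'a poly vec" and ?E = "E_mat r :: 'a poly mat"
  fix p assume "p < dim_vec ?r"
  then have p: "p < r + 1" by simp
  have idx: "?l $ p = (\<Sum>q<r + 1. ?E $$ (p, q) * ?v $ q)"
    using p by (simp add: E_mat_def lommel_vec_def scalar_prod_def lessThan_atLeast0)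
  show "?l $ p = ?r $ p"
  proof (cases "p = r")
    case True
    have "?l $ p = (\<Sum>q<r. c_entry (q + 1) * ?v $ q) + c_entry (r + 1) * ?v $ r"
      unfolding idx using True by (simp add: E_mat_def Let_def)
    also have "(\<Sum>q<r. c_entry (q + 1) * ?v $ q) =
       (\<Sum>k\<in>{1..r}. c_entry k * ([:2 * (2 * of_nat k - 1):] * lommel r k))"
      by (rule sum.reindex_bij_witness[of _ "\<lambda>k. k - 1" Suc]) (auto simp: lommel_vec_def)
    also have "\<dots> = [:0, 1:] * (\<Sum>k\<in>{1..r}. (-1) ^ (k + 1) * (lommel r (k - 1) - lommel r (k + 1)))"
      unfolding sum_distrib_left
    proof (rule sum.cong[OF refl])
      fix k assume "k \<in> {1..r}"
      then show "c_entry k * ([:2 * (2 * of_nat k - 1):] * lommel r k) =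
        [:0, 1:] * ((-1) ^ (k + 1) * (lommel r (k - 1) - lommel r (k + 1) :: 'a poly))"
        unfolding c_entry_def by (subst scaled_lommel) (simp_all only: atLeastAtMost_iff mult.left_commute)
    qed
    also have "(\<Sum>k\<in>{1..r}. (-1) ^ (k + 1) * (lommel r (k - 1) - lommel r (k + 1) :: 'a poly)) =
       lommel r 0 - lommel r 1 + (-1) ^ (r + 1) * lommel r r"
      by (subst sum_alternating_differences) (simp add: lommel_above)
    also have "c_entry (r + 1) * ?v $ r = (-1) ^ r * ([:0, 1:] * lommel r r)"
      by (simp add: c_entry_def lommel_vec_def)
    finally have "?l $ p = [:0, 1:] * (lommel r 0 - lommel r 1 + (-1) ^ (r + 1) * lommel r r)
       + (-1) ^ r * ([:0, 1:] * lommel r r)" .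
    also have "\<dots> = [:0, 1:] * (lommel r 0 - lommel r 1)"
      by (cases "even r") (simp_all add: algebra_simps del: mult_pCons_left mult_pCons_right)
    finally show ?thesis using True by simp
  next
    case False
    define k where "k = p + 1"
    have k: "1 \<le> k" "k \<le> r" "p = k - 1" using p False by (simp_all add: k_def)
    have "?l $ p = (\<Sum>q<r + 1. (if q = p then a_entry k * ?v $ p else 0)
        + (if q = p + 1 then - (?v $ (p + 1)) else 0)
        + (if q = p + 2 then (if k + 2 \<le> r then b_entry k * ?v $ (p + 2) else 0) else 0))"
      unfolding idx
      by (rule sum.cong[OF refl], insert p False) (auto simp: E_mat_def Let_def k_def)
    also have "\<dots> = a_entry k * ?v $ p - ?v $ (p + 1)
        + (if k + 2 \<le> r then b_entry k * ?v $ (p + 2) else 0)"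
      unfolding sum.distrib sum.delta[OF finite_lessThan] using p False by (auto simp: k_def)
    also have "a_entry k * ?v $ p = [:0, 1:] * lommel r k"
    proof -
      have "?v $ p = [:2 * (2 * of_nat k - 1):] * lommel r k"
        using p False by (simp add: lommel_vec_def k_def)
      then show ?thesis using a_entry_mult_scaled[of k, where 'a='a] k by simp
    qed
    \<comment> \<open>The missing entry in the rows k = r - 1 and k = r fits the same formula, as
      \<open>lommel r\<close> vanishes above index r.\<close>
    also have "(if k + 2 \<le> r then b_entry k * ?v $ (p + 2) else 0) = - ([:0, 1:] * lommel r (k + 2))"
    proof (cases "k + 2 \<le> r")
      case True
      have "?v $ (p + 2) = [:2 * (2 * of_nat (k + 2) - 1):] * lommel r (k + 2)"
        if "p + 2 < r"
        using that True by (simp add: lommel_vec_def k_def)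
      moreover have "p + 2 < r" using True by (simp add: k_def)
      ultimately have "a_entry (k + 2) * ?v $ (p + 2) = [:0, 1:] * lommel r (k + 2)"
        using a_entry_mult_scaled[of "k + 2", where 'a='a] by simp
      then show ?thesis using True by (simp add: b_entry_eq)
    next
      case False
      then show ?thesis by (simp add: lommel_above)
    qed
    \<comment> \<open>For k = r this is the exceptional last entry of \<open>lommel_vec\<close>,
      chosen so that row r vanishes as well.\<close>
    also have "?v $ (p + 1) = [:0, 1:] * (lommel r k - lommel r (k + 2))"
    proof (cases "k = r")
      case True
      then show ?thesis using k by (simp add: lommel_vec_def lommel_above)
    next
      case False
      then show ?thesis using k scaled_lommel[of "k + 1" r, where 'a='a]
        by (simp add: lommel_vec_def)
    qed
    finally show ?thesis using False p by (simp add: algebra_simps)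
  qed
qed (simp add: E_mat_def)

text \<open>Below the diagonal only the last row of \<open>E_mat r\<close> has nonzero entries.
  Without it and the last column, an upper triangular matrix with diagonal a_1, ..., a_r
  remains.\<close>

lemma cofactor_E_mat_last: "cofactor (E_mat r) r r = (lommel r r :: 'a::field_char_0 poly)"
proof -
  let ?D = "mat_delete (E_mat r :: 'a poly mat) r r"
  have D: "?D \<in> carrier_mat r r" using mat_delete_carrier[OF E_mat_carrier] by simp
  have "upper_triangular ?D"
    by (rule upper_triangularI) (simp add: mat_delete_def E_mat_def Let_def)
  then have "det ?D = prod_list (diag_mat ?D)" using D by (rule det_upper_triangular)
  also have "\<dots> = (\<Prod>i<r. a_entry (i + 1))"
    using D by (simp add: prod_list_diag_prod mat_delete_def E_mat_def Let_def lessThan_atLeast0)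
  also have "\<dots> = lommel r r"
    unfolding lommel_diag by (rule prod.reindex_bij_witness[of _ "\<lambda>k. k - 1" Suc]) auto
  finally show ?thesis by (simp add: cofactor_def)
qed

text \<open>The last component of adj(E) E v = det(E) v is read in two ways. Only the last entry of
  E v is nonzero, so a single cofactor enters, and it equals the last entry of v up to the variable;
  the common factor cancels.\<close>

lemma phi_lommel:
  assumes "r \<noteq> 0"
  shows "phi r = (lommel r 0 - lommel r 1 :: 'a::field_char_0 poly)"
proof -
  let ?E = "E_mat r :: 'a poly mat" and ?v = "lommel_vec r :: 'a poly vec"
  note E = E_mat_carrier[of r, where 'a='a]
  have v: "?v \<in> carrier_vec (r + 1)" by (simp add: lommel_vec_def)
  have "det ?E * ?v $ r = ((det ?E \<cdot>\<^sub>m 1\<^sub>m (r + 1)) *\<^sub>v ?v) $ r"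
    using v by (simp add: row_def[abs_def] scalar_prod_def if_distrib[of "\<lambda>x. x * _"] if_distrib[of "\<lambda>x. _ * x"] sum.delta cong: if_cong)
  also have "\<dots> = (adj_mat ?E *\<^sub>v (?E *\<^sub>v ?v)) $ r"
    unfolding assoc_mult_mat_vec[OF adj_mat(1)[OF E] E v, symmetric] adj_mat(3)[OF E] ..
  also have "\<dots> = cofactor ?E r r * ([:0, 1:] * (lommel r 0 - lommel r 1))"
    unfolding E_mat_lommel_vec[OF assms] using E
    by (simp add: adj_mat_def scalar_prod_def if_distrib[of "\<lambda>x. _ * x"] sum.delta cong: if_cong)
  finally have "([:0, 1:] * lommel r r) * det ?E = ([:0, 1:] * lommel r r) * (lommel r 0 - lommel r 1)"
    by (simp add: cofactor_E_mat_last lommel_vec_def ac_simps)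
  moreover have "[:0, 1:] * lommel r r \<noteq> (0 :: 'a poly)" using lommel_diag_nonzero by simp
  ultimately show ?thesis unfolding phi_def by (metis mult_left_cancel)
qed

text \<open>Both sides satisfy the same two-step recurrence in r, with equal values at r = 0 and r =
  1. The induction is therefore run on the \<open>lommel\<close> difference, which makes the start
  at r = 0 available.\<close>

lemma phi_eq_pade_num:
  assumes "r \<noteq> 0"
  shows "phi r = pcompose (pade_num r) [:0, - 1 :: 'a::field_char_0:]"
proof -
  have "lommel r 0 - lommel r 1 = pcompose (pade_num r) [:0, - 1 :: 'a:]" for r
  proof (induction r rule: induct_nat_012)
    case 0
    then show ?case by (simp add: pade_num_0 pcompose_1)
  next
    case 1
    then show ?case by (simp add: pade_num_1 pcompose_pCons a_entry_def monom_Suc monom_0 one_pCons)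
  next
    case (ge2 r)
    let ?c = "1 / (4 * (2 * of_nat r + 1) * (2 * of_nat r + 3)) :: 'a"
    have "pcompose (monom ?c 2) [:0, - 1:] = monom ?c 2"
      by (simp add: numeral_2_eq_2 monom_Suc monom_0 pcompose_pCons)
    also have "\<dots> = a_entry (Suc (Suc r)) * a_entry (Suc r)"
      by (simp add: a_entry_def mult_monom numeral_2_eq_2[symmetric] algebra_simps)
    finally have "pcompose (monom ?c 2) [:0, - 1:] = a_entry (Suc (Suc r)) * a_entry (Suc r)" .
    moreover have "lommel (Suc (Suc r)) l = lommel (Suc r) l +
        a_entry (Suc (Suc r)) * a_entry (Suc r) * (lommel r l :: 'a poly)" if "l \<le> 1" for l
      using that by (simp only: lommel.simps) simp
    ultimately show ?case
      using ge2.IH by (simp add: pade_num_rec pcompose_add pcompose_mult algebra_simps del: lommel.simps)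
  qed
  then show ?thesis by (simp only: phi_lommel[OF assms])
qed

lemma poly_phi: "r \<noteq> 0 \<Longrightarrow> poly (phi r) x = poly (pade_num r) (- x)"
  by (simp add: phi_eq_pade_num poly_pcompose)

lemma poly_pderiv_phi: "r \<noteq> 0 \<Longrightarrow> poly (pderiv (phi r)) x = - poly (pderiv (pade_num r)) (- x)"
  by (simp add: phi_eq_pade_num pderiv_pcompose poly_pcompose pderiv_pCons)

lemma degree_phi: "r \<noteq> 0 \<Longrightarrow> degree (phi r) = r"
  by (simp add: phi_eq_pade_num degree_pcompose degree_pade_num)

section \<open>Degrees of the minors\<close>

lemma degree_det_le:
  assumes A: "A \<in> carrier_mat n n"
    and deg: "\<And>i j. i < n \<Longrightarrow> j < n \<Longrightarrow> degree (A $$ (i, j)) \<le> d i"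
  shows "degree (det A) \<le> (\<Sum>i<n. d i)"
  unfolding det_def'[OF A]
proof (rule degree_sum_le)
  fix p assume "p \<in> {p. p permutes {0..<n}}"
  then have p: "p permutes {0..<n}" by simp
  have "degree (signof p * (\<Prod>i = 0..<n. A $$ (i, p i))) \<le> degree (\<Prod>i = 0..<n. A $$ (i, p i))"
    by (cases "sign p = 1") (simp_all add: sign_def)
  also have "\<dots> \<le> (\<Sum>i = 0..<n. degree (A $$ (i, p i)))"
    using degree_prod_sum_le[of "{0..<n}" "\<lambda>i. A $$ (i, p i)"] by (simp add: o_def)
  also have "\<dots> \<le> (\<Sum>i = 0..<n. d i)"
  proof (rule sum_mono)
    fix i assume "i \<in> {0..<n}"
    then show "degree (A $$ (i, p i)) \<le> d i"
      using permutes_in_image[OF p, of i] deg by simp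
  qed
  finally show "degree (signof p * (\<Prod>i = 0..<n. A $$ (i, p i))) \<le> (\<Sum>i<n. d i)"
    by (simp add: lessThan_atLeast0)
qed (simp add: finite_permutations)

lemma degree_det_less_row:
  assumes A: "A \<in> carrier_mat n n" and l: "l < n"
    and deg: "\<And>i j. i < n \<Longrightarrow> j < n \<Longrightarrow> degree (A $$ (i, j)) \<le> 1"
    and const: "\<And>j. j < n \<Longrightarrow> degree (A $$ (l, j)) = 0"
  shows "degree (det A) < n"
proof -
  have "degree (det A) \<le> (\<Sum>i<n. if i = l then 0 else 1)"
    using A by (rule degree_det_le) (use deg const in auto)
  also have "\<dots> < (\<Sum>i<n. 1)" using l by (intro sum_strict_mono_ex1) auto
  finally show ?thesis by simp
qed

lemma degree_det_less_col:
  assumes A: "A \<in> carrier_mat n n" and l: "l < n"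
    and deg: "\<And>i j. i < n \<Longrightarrow> j < n \<Longrightarrow> degree (A $$ (i, j)) \<le> 1"
    and const: "\<And>i. i < n \<Longrightarrow> degree (A $$ (i, l)) = 0"
  shows "degree (det A) < n"
  using degree_det_less_row[of "transpose_mat A" n l] assms by (simp add: det_transpose)

lemma degree_E_mat_entry:
  "p < r + 1 \<Longrightarrow> q < r + 1 \<Longrightarrow> degree (E_mat r $$ (p, q)) \<le> 1"
  by (auto simp: E_mat_def Let_def a_entry_def b_entry_def c_entry_def degree_monom_eq
      intro!: order.trans[OF degree_monom_le] order.trans[OF degree_power_le])

lemma degree_E_mat_last_row: "q < r + 1 \<Longrightarrow> degree (E_mat r $$ (r, q)) = 0"
  by (auto simp: E_mat_def Let_def c_entry_def minus_one_power_iff)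

lemma degree_E_mat_last_col: "p < r + 1 \<Longrightarrow> degree (E_mat r $$ (p, r)) = 0"
  by (auto simp: E_mat_def Let_def c_entry_def minus_one_power_iff)

text \<open>Every minor other than the last keeps a row or a column of constants.\<close>

lemma degree_phi_minor:
  assumes "1 \<le> r" "k \<in> {1..r + 1}" "i \<in> {1..r + 1}" "\<not> (k = r + 1 \<and> i = r + 1)"
  shows "degree (phi_minor r k i :: 'a::field_char_0 poly) < r"
proof -
  let ?D = "mat_delete (E_mat r :: 'a poly mat) (k - 1) (i - 1)"
  have D: "?D \<in> carrier_mat r r" using mat_delete_carrier[OF E_mat_carrier] by simp
  have deg: "degree (?D $$ (p, q)) \<le> 1" if "p < r" "q < r" for p q
    using that E_mat_carrier[of r, where 'a='a] unfolding mat_delete_def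
    by (auto intro!: degree_E_mat_entry[simplified])
  show ?thesis
  proof (cases "k = r + 1")
    case True
    then have "i \<le> r" using assms by auto
    \<comment> \<open>The constant last column survives the deletion of an earlier column and moves
      to position r - 1; in the other case the same happens to the last row.\<close>
    then have "degree (?D $$ (p, r - 1)) = 0" if "p < r" for p
      using that E_mat_carrier[of r, where 'a='a] assms unfolding mat_delete_def
      by (auto intro!: degree_E_mat_last_col[simplified])
    then show ?thesis unfolding phi_minor_def
      by (rule degree_det_less_col[OF D _ deg, rotated -1]) (use assms in auto)
  next
    case False
    then have "degree (?D $$ (r - 1, q)) = 0" if "q < r" for q
      using that E_mat_carrier[of r, where 'a='a] assms unfolding mat_delete_def
      by (auto intro!: degree_E_mat_last_row[simplified])
    then show ?thesis unfolding phi_minor_def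
      by (rule degree_det_less_row[OF D _ deg, rotated -1]) (use assms in auto)
  qed
qed

text \<open>In the Laplace expansion of \<open>phi r\<close> along the last row the corner minor
  carries the entry c_(r+1) = (-1)^r, and all other minors have degree below r. This is where the
  value at infinity comes from.\<close>

lemma degree_phi_minor_last:
  assumes "1 \<le> r"
  shows "degree (phi_minor r (r + 1) (r + 1) - (- 1) ^ r * phi r :: 'a::field_char_0 poly) < r"
proof -
  let ?E = "E_mat r :: 'a poly mat"
  have E: "?E \<in> carrier_mat (r + 1) (r + 1)" by (rule E_mat_carrier)
  have "phi r = (\<Sum>j<r + 1. ?E $$ (r, j) * cofactor ?E r j)"
    unfolding phi_def by (rule laplace_expansion_row[OF E]) simp
  also have "\<dots> = (\<Sum>j<r. ?E $$ (r, j) * cofactor ?E r j) + (- 1) ^ r * phi_minor r (r + 1) (r + 1)"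
    by (simp add: cofactor_def phi_minor_def E_mat_def Let_def c_entry_def)
  finally have "phi_minor r (r + 1) (r + 1) - (- 1) ^ r * phi r =
     - ((- 1) ^ r * (\<Sum>j<r. ?E $$ (r, j) * cofactor ?E r j))"
    by (cases "even r") simp_all
  moreover have "degree (\<Sum>j<r. ?E $$ (r, j) * cofactor ?E r j) < r"
  proof (rule degree_sum_less)
    fix j assume j: "j \<in> {..<r}"
    have "?E $$ (r, j) * cofactor ?E r j = (- 1) ^ j * (- 1) ^ (r + j) * phi_minor r (r + 1) (j + 1)"
      using j by (simp add: cofactor_def phi_minor_def E_mat_def Let_def c_entry_def)
    then show "degree (?E $$ (r, j) * cofactor ?E r j) < r"
      using degree_phi_minor[of r "r + 1" "j + 1", where 'a='a] j assms
      by (cases "even j"; cases "even r") simp_all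
  qed (use assms in simp)
  ultimately show ?thesis by (cases "even r") simp_all
qed

text \<open>Partial fractions with the denominator cleared, that is, Lagrange interpolation: \<psi>
  x vanishes on the other points of S, and \<psi> x at x is p'(x) by the product rule, so both sides
  agree on S and have degree below its cardinality. An identity of polynomials can be evaluated at a
  matrix.\<close>

lemma partial_fraction_interpolation:
  fixes p q :: "'a::field_char_0 poly"
  assumes fin: "finite S" and deg: "degree q < card S"
    and \<psi>: "\<And>x. x \<in> S \<Longrightarrow> p = [:- x, 1:] * \<psi> x"
    and deg\<psi>: "\<And>x. x \<in> S \<Longrightarrow> degree (\<psi> x) < card S"
    and simple: "\<And>x. x \<in> S \<Longrightarrow> poly (pderiv p) x \<noteq> 0"
  shows "q = (\<Sum>x\<in>S. smult (poly q x / poly (pderiv p) x) (\<psi> x))"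
proof (rule poly_eqI_degree[of S])
  fix x assume x: "x \<in> S"
  have "poly (\<psi> y) x = 0" if "y \<in> S" "y \<noteq> x" for y
  proof -
    have "poly ([:- y, 1:] * \<psi> y) x = poly ([:- x, 1:] * \<psi> x) x"
      using \<psi>[OF that(1)] \<psi>[OF x] by simp
    then show ?thesis using that by simp
  qed
  then have "poly (\<Sum>y\<in>S. smult (poly q y / poly (pderiv p) y) (\<psi> y)) x =
      (\<Sum>y\<in>S. if y = x then poly q x / poly (pderiv p) x * poly (\<psi> x) x else 0)"
    unfolding poly_sum by (intro sum.cong) auto
  also have "\<dots> = poly q x / poly (pderiv p) x * poly (\<psi> x) x"
    using x fin by (simp add: sum.delta)
  also have "poly (\<psi> x) x = poly (pderiv p) x"
    by (subst \<psi>[OF x]) (simp add: pderiv_mult pderiv_pCons del: mult_pCons_left)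
  finally show "poly q x = poly (\<Sum>y\<in>S. smult (poly q y / poly (pderiv p) y) (\<psi> y)) x"
    using simple[OF x] by simp
next
  show "degree (\<Sum>y\<in>S. smult (poly q y / poly (pderiv p) y) (\<psi> y)) < card S"
    using deg deg\<psi> by (intro degree_sum_less order.strict_trans1[OF degree_smult_le]) auto
qed (fact deg)

section \<open>Polynomials acting on vectors\<close>

lemma poly_mat_carrier [simp]: "Q \<in> carrier_mat n n \<Longrightarrow> poly_mat p Q \<in> carrier_mat n n"
  by (auto simp: poly_mat_def)

text \<open>The flexible bound m is for \<open>pCons a p\<close>, whose degree is not the successor
  of that of p when p = 0.\<close>

lemma index_poly_mat:
  assumes "Q \<in> carrier_mat n n" "s < n" "u < n" "degree p \<le> m"
  shows "poly_mat p Q $$ (s, u) = (\<Sum>i\<le>m. coeff p i * (Q ^\<^sub>m i) $$ (s, u))"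
proof -
  have "poly_mat p Q $$ (s, u) = (\<Sum>i\<le>degree p. coeff p i * (Q ^\<^sub>m i) $$ (s, u))"
    using assms by (simp add: poly_mat_def)
  also have "\<dots> = (\<Sum>i\<le>m. coeff p i * (Q ^\<^sub>m i) $$ (s, u))"
    using assms(4) by (intro sum.mono_neutral_left) (auto simp: coeff_eq_0)
  finally show ?thesis .
qed

lemma poly_mat_0: "Q \<in> carrier_mat n n \<Longrightarrow> poly_mat 0 Q = 0\<^sub>m n n"
  by (rule eq_matI) (auto simp: poly_mat_def)

lemma poly_mat_pCons:
  assumes Q: "Q \<in> carrier_mat n n"
  shows "poly_mat (pCons a p) Q = a \<cdot>\<^sub>m 1\<^sub>m n + poly_mat p Q * Q"
proof (rule eq_matI)
  fix s u assume "s < dim_row (a \<cdot>\<^sub>m 1\<^sub>m n + poly_mat p Q * Q)"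
    and "u < dim_col (a \<cdot>\<^sub>m 1\<^sub>m n + poly_mat p Q * Q)"
  then have su: "s < n" "u < n" using Q poly_mat_carrier[OF Q, of p] by auto
  have "(poly_mat p Q * Q) $$ (s, u) = (\<Sum>w<n. poly_mat p Q $$ (s, w) * Q $$ (w, u))"
    using su Q by (simp add: scalar_prod_def lessThan_atLeast0 poly_mat_def)
  also have "\<dots> = (\<Sum>w<n. \<Sum>i\<le>degree p. coeff p i * ((Q ^\<^sub>m i) $$ (s, w) * Q $$ (w, u)))"
    using su by (intro sum.cong[OF refl]) (simp add: index_poly_mat[OF Q _ _ order_refl] sum_distrib_right mult.assoc)
  also have "\<dots> = (\<Sum>i\<le>degree p. coeff p i * (\<Sum>w<n. (Q ^\<^sub>m i) $$ (s, w) * Q $$ (w, u)))"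
    by (subst sum.swap) (simp add: sum_distrib_left)
  also have "\<dots> = (\<Sum>i\<le>degree p. coeff p i * (Q ^\<^sub>m Suc i) $$ (s, u))"
    using su Q pow_carrier_mat[OF Q] by (intro sum.cong[OF refl]) (simp add: scalar_prod_def lessThan_atLeast0)
  finally have PQ: "(poly_mat p Q * Q) $$ (s, u) = \<dots>" .
  have "poly_mat (pCons a p) Q $$ (s, u) = (\<Sum>i\<le>Suc (degree p). coeff (pCons a p) i * (Q ^\<^sub>m i) $$ (s, u))"
    by (rule index_poly_mat[OF Q su]) (rule degree_pCons_le)
  also have "\<dots> = a * (1\<^sub>m n) $$ (s, u) + (\<Sum>i\<le>degree p. coeff p i * (Q ^\<^sub>m Suc i) $$ (s, u))"
    unfolding sum.atMost_Suc_shift using Q by (simp del: pow_mat.simps(2))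
  finally show "poly_mat (pCons a p) Q $$ (s, u) = (a \<cdot>\<^sub>m 1\<^sub>m n + poly_mat p Q * Q) $$ (s, u)"
    unfolding PQ[symmetric] using su Q carrier_matD[OF poly_mat_carrier[OF Q, of p]] by simp
qed (use assms in \<open>auto simp: poly_mat_def\<close>)

lemma zero_mat_mult_vec: "v \<in> carrier_vec n \<Longrightarrow> 0\<^sub>m m n *\<^sub>v v = (0\<^sub>v m :: 'a::semiring_0 vec)"
  by (rule eq_vecI) auto

lemma mult_mat_zero_vec: "A \<in> carrier_mat m n \<Longrightarrow> A *\<^sub>v 0\<^sub>v n = (0\<^sub>v m :: 'a::semiring_0 vec)"
  by (rule eq_vecI) auto

lemma smult_zero_vec: "c \<cdot>\<^sub>v 0\<^sub>v n = (0\<^sub>v n :: 'a::mult_zero vec)"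
  by (rule eq_vecI) auto

lemma smult_mat_mult_vec:
  "A \<in> carrier_mat m n \<Longrightarrow> v \<in> carrier_vec n \<Longrightarrow> (a \<cdot>\<^sub>m A) *\<^sub>v v = a \<cdot>\<^sub>v (A *\<^sub>v v)"
  by (rule eq_vecI) (auto simp: scalar_prod_def sum_distrib_left mult.assoc)

lemma mult_mat_finsum_vec:
  fixes A :: "'a::comm_ring_1 mat"
  assumes A: "A \<in> carrier_mat m n" and "finite K" and "f \<in> K \<rightarrow> carrier_vec n"
  shows "A *\<^sub>v finsum_vec TYPE('a) n f K = finsum_vec TYPE('a) m (\<lambda>k. A *\<^sub>v f k) K"
  using assms(2,3)
proof (induction K rule: finite_induct)
  case empty
  then show ?case using A by (simp add: finsum_vec_empty mult_mat_zero_vec)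
next
  case (insert k K)
  have "A *\<^sub>v finsum_vec TYPE('a) n f (insert k K) = A *\<^sub>v (f k + finsum_vec TYPE('a) n f K)"
    using insert by (subst finsum_vec_insert) auto
  also have "\<dots> = A *\<^sub>v f k + A *\<^sub>v finsum_vec TYPE('a) n f K"
    using insert by (intro mult_add_distrib_mat_vec[OF A] finsum_vec_closed[of f K]) auto
  also have "\<dots> = finsum_vec TYPE('a) m (\<lambda>k. A *\<^sub>v f k) (insert k K)"
    using insert by (subst finsum_vec_insert) (auto simp: Pi_iff intro!: mult_mat_vec_carrier[OF A])
  finally show ?case .
qed

context
  fixes Q :: "'a::field mat" and n :: nat
  assumes Q: "Q \<in> carrier_mat n n"
begin

lemma poly_mat_vec_closed [simp]: "v \<in> carrier_vec n \<Longrightarrow> poly_mat p Q *\<^sub>v v \<in> carrier_vec n"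
  using poly_mat_carrier[OF Q] by (rule mult_mat_vec_carrier)

lemma poly_mat_vec_0: "v \<in> carrier_vec n \<Longrightarrow> poly_mat 0 Q *\<^sub>v v = 0\<^sub>v n"
  by (simp add: poly_mat_0[OF Q] zero_mat_mult_vec)

text \<open>Horner's rule, from which the calculus below follows by induction on the polynomial. The
  factor Q acts on the vector, so these inductions generalize v.\<close>

lemma poly_mat_vec_pCons:
  assumes v: "v \<in> carrier_vec n"
  shows "poly_mat (pCons a p) Q *\<^sub>v v = a \<cdot>\<^sub>v v + poly_mat p Q *\<^sub>v (Q *\<^sub>v v)"
proof -
  have "(poly_mat p Q * Q) *\<^sub>v v = poly_mat p Q *\<^sub>v (Q *\<^sub>v v)"
    using poly_mat_carrier[OF Q] Q v by (rule assoc_mult_mat_vec)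
  moreover have "(a \<cdot>\<^sub>m 1\<^sub>m n + poly_mat p Q * Q) *\<^sub>v v = (a \<cdot>\<^sub>m 1\<^sub>m n) *\<^sub>v v + (poly_mat p Q * Q) *\<^sub>v v"
    using mult_carrier_mat[OF poly_mat_carrier[OF Q] Q] v
    by (intro add_mult_distrib_mat_vec[of _ n n]) auto
  ultimately show ?thesis
    using v by (simp add: poly_mat_pCons[OF Q] smult_mat_mult_vec[of _ n n])
qed

lemma poly_mat_vec_linear:
  assumes v: "v \<in> carrier_vec n"
  shows "poly_mat [:z, 1:] Q *\<^sub>v v = (z \<cdot>\<^sub>m 1\<^sub>m n + Q) *\<^sub>v v"
proof -
  have "poly_mat [:z, 1:] Q = z \<cdot>\<^sub>m 1\<^sub>m n + Q"
    by (rule eq_matI) (use Q in \<open>auto simp: poly_mat_pCons[OF Q] poly_mat_0[OF Q]\<close>)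
  then show ?thesis by simp
qed

lemma poly_mat_vec_add:
  assumes "v \<in> carrier_vec n"
  shows "poly_mat (p + q) Q *\<^sub>v v = poly_mat p Q *\<^sub>v v + poly_mat q Q *\<^sub>v v"
  using assms
proof (induction p q arbitrary: v rule: poly_induct2)
  case 0
  then show ?case by (simp add: poly_mat_vec_0)
next
  case (pCons a p b q)
  have Qv: "Q *\<^sub>v v \<in> carrier_vec n" using Q pCons.prems by simp
  have "(a + b) \<cdot>\<^sub>v v + (x + y) = (a \<cdot>\<^sub>v v + x) + (b \<cdot>\<^sub>v v + y)"
    if "x \<in> carrier_vec n" "y \<in> carrier_vec n" for x y
    using pCons.prems that by (intro eq_vecI) (auto simp: algebra_simps)
  then show ?case
    using pCons.prems Qv by (simp only: poly_mat_vec_pCons pCons.IH add_pCons poly_mat_vec_closed)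
qed

lemma poly_mat_vec_smult:
  assumes "v \<in> carrier_vec n"
  shows "poly_mat (smult c p) Q *\<^sub>v v = c \<cdot>\<^sub>v (poly_mat p Q *\<^sub>v v)"
  using assms
proof (induction p arbitrary: v rule: pCons_induct)
  case 0
  then show ?case by (simp add: poly_mat_vec_0 smult_zero_vec)
next
  case (pCons a p)
  have "Q *\<^sub>v v \<in> carrier_vec n" using Q pCons.prems by simp
  from this pCons.IH[OF this] show ?case
    using pCons.prems Q by (simp add: poly_mat_vec_pCons smult_add_distrib_vec[of _ n] smult_smult_assoc)
qed

lemma poly_mat_vec_commute:
  assumes "v \<in> carrier_vec n"
  shows "poly_mat p Q *\<^sub>v (Q *\<^sub>v v) = Q *\<^sub>v (poly_mat p Q *\<^sub>v v)"
  using assms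
proof (induction p arbitrary: v rule: pCons_induct)
  case 0
  then show ?case using Q by (simp add: poly_mat_vec_0 mult_mat_zero_vec)
next
  case (pCons a p)
  have Qv: "Q *\<^sub>v v \<in> carrier_vec n" using Q pCons.prems by simp
  have "Q *\<^sub>v (a \<cdot>\<^sub>v v + poly_mat p Q *\<^sub>v (Q *\<^sub>v v)) =
      a \<cdot>\<^sub>v (Q *\<^sub>v v) + Q *\<^sub>v (poly_mat p Q *\<^sub>v (Q *\<^sub>v v))"
    using Q pCons.prems Qv by (simp add: mult_add_distrib_mat_vec[of _ n n] mult_mat_vec[of _ n n])
  then show ?case
    using Qv pCons.prems by (simp add: poly_mat_vec_pCons pCons.IH)
qed

lemma poly_mat_vec_mult:
  assumes "v \<in> carrier_vec n"
  shows "poly_mat (p * q) Q *\<^sub>v v = poly_mat p Q *\<^sub>v (poly_mat q Q *\<^sub>v v)"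
  using assms
proof (induction p arbitrary: v rule: pCons_induct)
  case 0
  then show ?case by (simp add: poly_mat_vec_0)
next
  case (pCons a p)
  have Qv: "Q *\<^sub>v v \<in> carrier_vec n" using Q pCons.prems by simp
  have zero_smult: "0 \<cdot>\<^sub>v v + x = x" if "x \<in> carrier_vec n" for x
    using pCons.prems that by (intro eq_vecI) auto
  have "poly_mat (smult a q + pCons 0 (p * q)) Q *\<^sub>v v =
     a \<cdot>\<^sub>v (poly_mat q Q *\<^sub>v v) + poly_mat (p * q) Q *\<^sub>v (Q *\<^sub>v v)"
    using pCons.prems Qv
    by (simp add: poly_mat_vec_add poly_mat_vec_smult poly_mat_vec_pCons zero_smult)
  also have "\<dots> = a \<cdot>\<^sub>v (poly_mat q Q *\<^sub>v v) + poly_mat p Q *\<^sub>v (Q *\<^sub>v (poly_mat q Q *\<^sub>v v))"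
    using pCons.prems Qv by (simp add: pCons.IH poly_mat_vec_commute)
  finally show ?case using pCons.prems by (simp add: poly_mat_vec_pCons)
qed

text \<open>The componentwise form makes the right-hand side a sum of scalars, which can be swapped
  and reindexed freely.\<close>

lemma poly_mat_vec_sum:
  assumes v: "v \<in> carrier_vec n" and s: "s < n"
  shows "(poly_mat (\<Sum>k\<in>K. p k) Q *\<^sub>v v) $ s = (\<Sum>k\<in>K. (poly_mat (p k) Q *\<^sub>v v) $ s)"
proof (induction K rule: infinite_finite_induct)
  case (insert k K)
  have "dim_vec (poly_mat q Q *\<^sub>v v) = n" for q using Q by (simp add: poly_mat_def)
  then show ?case using insert s by (simp add: poly_mat_vec_add[OF v] del: index_mult_mat_vec)
qed (use s in \<open>simp_all add: poly_mat_vec_0[OF v] del: index_mult_mat_vec\<close>)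

text \<open>The flat sum of length m' * n is cut into m' groups of length n; on each group
  \<open>div\<close> is the constant block column and \<open>mod\<close> runs through the
  block.\<close>

lemma vec_block_poly_block_mat:
  assumes E: "E \<in> carrier_mat m m'" and X: "X \<in> carrier_vec (m' * n)" and p: "p < m"
  shows "vec_block n (poly_block_mat E Q *\<^sub>v X) p =
    finsum_vec TYPE('a) n (\<lambda>q. poly_mat (E $$ (p, q)) Q *\<^sub>v vec_block n X q) {..<m'}"
    (is "?l = ?r")
proof (rule eq_vecI)
  have cl: "(\<lambda>q. poly_mat (E $$ (p, q)) Q *\<^sub>v vec_block n X q) \<in> {..<m'} \<rightarrow> carrier_vec n"
    by (auto simp: vec_block_def)
  then have r: "?r \<in> carrier_vec n" by (rule finsum_vec_closed)
  then show "dim_vec ?l = dim_vec ?r" by (simp add: vec_block_def)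
  fix s assume "s < dim_vec ?r"
  then have s: "s < n" using r by simp
  have "p * n + s < p * n + n" using s by simp
  also have "\<dots> \<le> m * n" using p mult_le_mono1[of "Suc p" m n] by simp
  finally have ps: "p * n + s < m * n" .
  have dm: "(p * n + s) div n = p" "(p * n + s) mod n = s" using s by simp_all
  have "?l $ s = (\<Sum>l<m' * n. poly_mat (E $$ (p, l div n)) Q $$ (s, l mod n) * X $ l)"
    using s ps dm E X Q by (simp add: vec_block_def poly_block_mat_def Let_def scalar_prod_def lessThan_atLeast0)
  also have "\<dots> = (\<Sum>q<m'. \<Sum>l\<in>{q * n..<q * n + n}. poly_mat (E $$ (p, l div n)) Q $$ (s, l mod n) * X $ l)"
    by (rule sum.nat_group[symmetric])
  also have "\<dots> = (\<Sum>q<m'. (poly_mat (E $$ (p, q)) Q *\<^sub>v vec_block n X q) $ s)"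
  proof (rule sum.cong[OF refl])
    fix q
    have qu: "l div n = q \<and> l mod n = l - q * n" if "l \<in> {q * n..<q * n + n}" for l
    proof -
      have "l div n = q" using that by (intro div_nat_eqI) (simp_all add: mult.commute)
      then show ?thesis using minus_div_mult_eq_mod[of l n] by simp
    qed
    have "(\<Sum>l\<in>{q * n..<q * n + n}. poly_mat (E $$ (p, l div n)) Q $$ (s, l mod n) * X $ l) =
       (\<Sum>u<n. poly_mat (E $$ (p, q)) Q $$ (s, u) * X $ (q * n + u))"
      by (rule sum.reindex_bij_witness[of _ "\<lambda>u. q * n + u" "\<lambda>l. l - q * n"])
        (use qu in auto)
    then show "(\<Sum>l\<in>{q * n..<q * n + n}. poly_mat (E $$ (p, l div n)) Q $$ (s, l mod n) * X $ l) =
       (poly_mat (E $$ (p, q)) Q *\<^sub>v vec_block n X q) $ s"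
      using s Q by (simp add: poly_mat_def vec_block_def scalar_prod_def lessThan_atLeast0)
  qed
  also have "\<dots> = ?r $ s" by (rule index_finsum_vec[OF _ s cl, symmetric]) simp
  finally show "?l $ s = ?r $ s" .
qed

text \<open>By multiplicativity of the evaluation at Q, the products of cofactors and entries are
  formed in the commutative polynomial ring, where adj(E) E = det(E) I removes all blocks but X_i
  before Q is inserted. It serves both for the solution formula and, with zero right-hand side, for
  the injectivity of the block matrix.\<close>

lemma poly_block_mat_cramer:
  assumes E: "E \<in> carrier_mat m m" and X: "X \<in> carrier_vec (m * n)" and i: "i < m"
  shows "poly_mat (det E) Q *\<^sub>v vec_block n X i =
    finsum_vec TYPE('a) n (\<lambda>p. poly_mat (cofactor E p i) Q *\<^sub>v vec_block n (poly_block_mat E Q *\<^sub>v X) p) {..<m}"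
    (is "?l = ?r")
proof (rule eq_vecI)
  have bl: "vec_block n Z q \<in> carrier_vec n" for Z :: "'a vec" and q by (simp add: vec_block_def)
  have cl: "(\<lambda>p. poly_mat (cofactor E p i) Q *\<^sub>v vec_block n (poly_block_mat E Q *\<^sub>v X) p) \<in> {..<m} \<rightarrow> carrier_vec n"
    by (auto simp: bl)
  then have r: "?r \<in> carrier_vec n" by (rule finsum_vec_closed)
  then show "dim_vec ?l = dim_vec ?r" using Q by (simp add: poly_mat_def)
  fix s assume "s < dim_vec ?r"
  then have s: "s < n" using r by simp
  have "?r $ s = (\<Sum>p<m. (poly_mat (cofactor E p i) Q *\<^sub>v vec_block n (poly_block_mat E Q *\<^sub>v X) p) $ s)"
    by (rule index_finsum_vec[OF _ s cl]) simp
  also have "\<dots> = (\<Sum>p<m. \<Sum>q<m. (poly_mat (cofactor E p i * E $$ (p, q)) Q *\<^sub>v vec_block n X q) $ s)"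
  proof (rule sum.cong[OF refl])
    fix p assume "p \<in> {..<m}"
    then have "poly_mat (cofactor E p i) Q *\<^sub>v vec_block n (poly_block_mat E Q *\<^sub>v X) p =
      finsum_vec TYPE('a) n (\<lambda>q. poly_mat (cofactor E p i) Q *\<^sub>v (poly_mat (E $$ (p, q)) Q *\<^sub>v vec_block n X q)) {..<m}"
      using bl by (subst vec_block_poly_block_mat[OF E X], simp,
          subst mult_mat_finsum_vec[OF poly_mat_carrier[OF Q]]) auto
    also have "\<dots> $ s = (\<Sum>q<m. (poly_mat (cofactor E p i) Q *\<^sub>v (poly_mat (E $$ (p, q)) Q *\<^sub>v vec_block n X q)) $ s)"
      using s bl by (intro index_finsum_vec) auto
    finally show "(poly_mat (cofactor E p i) Q *\<^sub>v vec_block n (poly_block_mat E Q *\<^sub>v X) p) $ s =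
       (\<Sum>q<m. (poly_mat (cofactor E p i * E $$ (p, q)) Q *\<^sub>v vec_block n X q) $ s)"
      by (simp only: poly_mat_vec_mult[OF bl])
  qed
  also have "\<dots> = (\<Sum>q<m. (poly_mat (\<Sum>p<m. cofactor E p i * E $$ (p, q)) Q *\<^sub>v vec_block n X q) $ s)"
    by (subst sum.swap) (simp only: poly_mat_vec_sum[OF bl s])
  also have "\<dots> = (\<Sum>q<m. if q = i then ?l $ s else 0)"
  proof (rule sum.cong[OF refl])
    fix q assume "q \<in> {..<m}"
    then have "(\<Sum>p<m. cofactor E p i * E $$ (p, q)) = (adj_mat E * E) $$ (i, q)"
      using E i by (simp add: adj_mat_def scalar_prod_def lessThan_atLeast0)
    also have "\<dots> = (if q = i then det E else 0)"
      unfolding adj_mat(3)[OF E] using i \<open>q \<in> _\<close> by simp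
    finally show "(poly_mat (\<Sum>p<m. cofactor E p i * E $$ (p, q)) Q *\<^sub>v vec_block n X q) $ s =
        (if q = i then ?l $ s else 0)"
      using s by (simp add: poly_mat_vec_0[OF bl] del: index_mult_mat_vec)
  qed
  also have "\<dots> = ?l $ s" using i by simp
  finally show "?l $ s = ?r $ s" by simp
qed

text \<open>Removes a resolvent: as \<phi> is \<psi> times a linear factor, \<phi> at Q factors
  through z + Q, which cancels the inverse.\<close>

lemma mult_mat_inv_vec:
  assumes "invertible_mat (z \<cdot>\<^sub>m 1\<^sub>m n + Q)" and "\<phi> = [:z, 1:] * \<psi>" and g: "g \<in> carrier_vec n"
  shows "mat_inv (z \<cdot>\<^sub>m 1\<^sub>m n + Q) *\<^sub>v g \<in> carrier_vec n"
    and "poly_mat \<phi> Q *\<^sub>v (mat_inv (z \<cdot>\<^sub>m 1\<^sub>m n + Q) *\<^sub>v g) = poly_mat \<psi> Q *\<^sub>v g"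
proof -
  let ?A = "z \<cdot>\<^sub>m 1\<^sub>m n + Q"
  have A: "?A \<in> carrier_mat n n" using Q by simp
  obtain B where AB: "?A * B = 1\<^sub>m n" "B * ?A = 1\<^sub>m (dim_row B)"
    using assms(1) A unfolding invertible_mat_def inverts_mat_def by auto
  \<comment> \<open>\<open>invertible_mat\<close> does not state the dimensions of the inverse; they
    are read off from the two identity matrices.\<close>
  have "dim_col B = n" using arg_cong[OF AB(1), of dim_col] by simp
  moreover have "dim_row B = n" using arg_cong[OF AB(2), of dim_col] carrier_matD[OF A] by auto
  ultimately have B: "B \<in> carrier_mat n n" by auto
  \<comment> \<open>Membership in the unit group excludes the result \<open>None\<close> of
    \<open>mat_inverse\<close>, so that \<open>the\<close> in \<open>mat_inv\<close> returns the
    actual inverse.\<close>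
  have "?A \<in> Units (ring_mat TYPE('a) n ())"
    using A B AB unfolding Units_def ring_mat_def by auto
  then obtain C where "mat_inverse ?A = Some C"
    using mat_inverse(1)[OF A, where b = "()"] by (cases "mat_inverse ?A") auto
  with mat_inverse(2)[OF A this] have C: "mat_inv ?A \<in> carrier_mat n n" "?A * mat_inv ?A = 1\<^sub>m n"
    unfolding mat_inv_def by auto
  show h: "mat_inv ?A *\<^sub>v g \<in> carrier_vec n" using C(1) g by simp
  have "poly_mat [:z, 1:] Q *\<^sub>v (mat_inv ?A *\<^sub>v g) = g"
    unfolding poly_mat_vec_linear[OF h] using assoc_mult_mat_vec[OF A C(1) g] C(2) g by simp
  then show "poly_mat \<phi> Q *\<^sub>v (mat_inv ?A *\<^sub>v g) = poly_mat \<psi> Q *\<^sub>v g"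
    unfolding assms(2) mult.commute[of "[:z, 1:]"] poly_mat_vec_mult[OF h] by simp
qed

end

section \<open>Injectivity and invertibility\<close>

lemma invertible_mat_if_injective:
  fixes A :: "'a::field mat"
  assumes A: "A \<in> carrier_mat n n" and inj: "\<And>v. v \<in> carrier_vec n \<Longrightarrow> A *\<^sub>v v = 0\<^sub>v n \<Longrightarrow> v = 0\<^sub>v n"
  shows "invertible_mat A"
proof -
  have "det A \<noteq> 0" using det_0_iff_vec_prod_zero_field[OF A] inj by blast
  from det_non_zero_imp_unit[OF A this, of "()"] obtain B where "B \<in> carrier_mat n n" "B * A = 1\<^sub>m n" "A * B = 1\<^sub>m n"
    unfolding Units_def ring_mat_def by auto
  then show ?thesis using A unfolding invertible_mat_def inverts_mat_def by auto
qed

lemma ex1_solution_if_invertible: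
  assumes A: "A \<in> carrier_mat n n" and "invertible_mat A" and b: "b \<in> carrier_vec n"
  shows "\<exists>!x. x \<in> carrier_vec n \<and> A *\<^sub>v x = b"
proof -
  obtain B where AB: "A * B = 1\<^sub>m n" "B * A = 1\<^sub>m (dim_row B)"
    using assms(1,2) unfolding invertible_mat_def inverts_mat_def by auto
  have "dim_col B = n" using arg_cong[OF AB(1), of dim_col] by simp
  moreover have "dim_row B = n" using arg_cong[OF AB(2), of dim_col] A by simp
  ultimately have B: "B \<in> carrier_mat n n" by auto
  show ?thesis
  proof (rule ex1I[of _ "B *\<^sub>v b"])
    show "B *\<^sub>v b \<in> carrier_vec n \<and> A *\<^sub>v (B *\<^sub>v b) = b"
      using assoc_mult_mat_vec[OF A B b] AB B b by simp
    fix x assume "x \<in> carrier_vec n \<and> A *\<^sub>v x = b"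
    then show "x = B *\<^sub>v b"
      using assoc_mult_mat_vec[OF B A, of x] AB B by auto
  qed
qed

text \<open>Over the complex numbers p splits into linear factors. One of them is placed outermost
  and stripped by its injectivity, which lowers the degree until a nonzero constant is left.\<close>

lemma poly_mat_vec_injective:
  fixes p :: "complex poly"
  assumes Q: "Q \<in> carrier_mat n n" and "p \<noteq> 0"
    and inj: "\<And>z v. poly p z = 0 \<Longrightarrow> v \<in> carrier_vec n \<Longrightarrow> (- z \<cdot>\<^sub>m 1\<^sub>m n + Q) *\<^sub>v v = 0\<^sub>v n \<Longrightarrow> v = 0\<^sub>v n"
    and v: "v \<in> carrier_vec n" and "poly_mat p Q *\<^sub>v v = 0\<^sub>v n"
  shows "v = 0\<^sub>v n"
  using assms(2,3,5)
proof (induction "degree p" arbitrary: p rule: less_induct)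
  case less
  show ?case
  proof (cases "degree p = 0")
    case True
    then obtain a where p: "p = [:a:]" by (rule degree_eq_zeroE)
    then have a: "a \<cdot>\<^sub>v v = 0\<^sub>v n" "a \<noteq> 0"
      using less.prems Q v by (simp_all add: poly_mat_vec_pCons[OF Q] poly_mat_vec_0[OF Q])
    show ?thesis
    proof (rule eq_vecI)
      fix s assume s: "s < dim_vec (0\<^sub>v n :: complex vec)"
      then show "v $ s = (0\<^sub>v n) $ s" using arg_cong[OF a(1), of "\<lambda>w. w $ s"] a(2) v by simp
    qed (use v in simp)
  next
    case False
    then obtain z where z: "poly p z = 0"
      using fundamental_theorem_of_algebra[of p] by (auto simp: constant_degree)
    then obtain q where p: "p = [:- z, 1:] * q" unfolding poly_eq_0_iff_dvd by (elim dvdE)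
    then have q: "q \<noteq> 0" using less.prems by auto
    have w: "poly_mat q Q *\<^sub>v v \<in> carrier_vec n" using Q v by simp
    have "(- z \<cdot>\<^sub>m 1\<^sub>m n + Q) *\<^sub>v (poly_mat q Q *\<^sub>v v) = 0\<^sub>v n"
      using less.prems(3) unfolding p poly_mat_vec_mult[OF Q v] poly_mat_vec_linear[OF Q w] .
    then have "poly_mat q Q *\<^sub>v v = 0\<^sub>v n" using less.prems(2)[OF z w] by blast
    moreover have "degree q < degree p" unfolding p using q by (subst degree_mult_eq) auto
    ultimately show ?thesis
      using less.hyps[of q] q less.prems(2) by (auto simp: p)
  qed
qed

text \<open>Pair the equation with v in the Hermitian product and take real parts. For v = x + i y
  and real Q the cross terms are purely imaginary, so the form contributes x \<bullet> Q x + y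
  \<bullet> Q y \<le> 0. Thus 0 \<le> Re z |v|^2, which forces v = 0.\<close>

lemma shifted_dissipative_injective:
  fixes Q :: "real mat" and z :: complex
  assumes Q: "Q \<in> carrier_mat n n" and diss: "\<And>x. x \<in> carrier_vec n \<Longrightarrow> x \<bullet> (Q *\<^sub>v x) \<le> 0"
    and z: "Re z < 0" and v: "v \<in> carrier_vec n"
    and eq: "(z \<cdot>\<^sub>m 1\<^sub>m n + map_mat complex_of_real Q) *\<^sub>v v = 0\<^sub>v n"
  shows "v = 0\<^sub>v n"
proof -
  let ?x = "map_vec Re v" and ?y = "map_vec Im v"
  have comp: "z * v $ s + (\<Sum>u<n. complex_of_real (Q $$ (s, u)) * v $ u) = 0" if s: "s < n" for s
  proof -
    have "((z \<cdot>\<^sub>m 1\<^sub>m n) *\<^sub>v v + map_mat complex_of_real Q *\<^sub>v v) $ s = 0"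
      using eq s Q v by (subst add_mult_distrib_mat_vec[of _ n n, symmetric]) auto
    then show ?thesis
      using s Q v by (simp add: smult_mat_mult_vec[of _ n n] scalar_prod_def lessThan_atLeast0)
  qed
  have quad: "w \<bullet> (Q *\<^sub>v w) = (\<Sum>s<n. w $ s * (\<Sum>u<n. Q $$ (s, u) * w $ u))"
    if "w \<in> carrier_vec n" for w
    using that Q by (simp add: scalar_prod_def lessThan_atLeast0)
  have "0 = Re (\<Sum>s<n. cnj (v $ s) * (z * v $ s + (\<Sum>u<n. complex_of_real (Q $$ (s, u)) * v $ u)))"
    using comp by simp
  also have "\<dots> = (\<Sum>s<n. Re z * (cmod (v $ s))\<^sup>2) +
      (\<Sum>s<n. Re (v $ s) * (\<Sum>u<n. Q $$ (s, u) * Re (v $ u))) +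
      (\<Sum>s<n. Im (v $ s) * (\<Sum>u<n. Q $$ (s, u) * Im (v $ u)))"
    unfolding Re_sum sum.distrib[symmetric] cmod_power2
    by (intro sum.cong[OF refl]) (simp add: algebra_simps power2_eq_square)
  also have "\<dots> = Re z * (\<Sum>s<n. (cmod (v $ s))\<^sup>2) + ?x \<bullet> (Q *\<^sub>v ?x) + ?y \<bullet> (Q *\<^sub>v ?y)"
    using v by (simp add: quad sum_distrib_left)
  also have "\<dots> \<le> Re z * (\<Sum>s<n. (cmod (v $ s))\<^sup>2)"
    using diss[of ?x] diss[of ?y] v by simp
  finally have "(\<Sum>s<n. (cmod (v $ s))\<^sup>2) \<le> 0" using z by (simp add: zero_le_mult_iff)
  then have "(\<Sum>s<n. (cmod (v $ s))\<^sup>2) = 0" by (intro antisym sum_nonneg) simp_all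
  then have "\<forall>s<n. v $ s = 0" by (simp add: sum_nonneg_eq_0_iff)
  then show ?thesis using v by (intro eq_vecI) auto
qed

section \<open>Scalar extension of matrix polynomials, and access to blocks\<close>

lemma map_mat_poly_mat:
  assumes Q: "Q \<in> carrier_mat n n"
  shows "map_mat complex_of_real (poly_mat p Q) = poly_mat (map_poly of_real p) (map_mat of_real Q)"
proof (rule eq_matI)
  fix s u assume "s < dim_row (poly_mat (map_poly of_real p) (map_mat complex_of_real Q))"
    "u < dim_col (poly_mat (map_poly of_real p) (map_mat complex_of_real Q))"
  then have su: "s < n" "u < n" using Q by (auto simp: poly_mat_def)
  have "(map_mat complex_of_real Q ^\<^sub>m i) $$ (s, u) = of_real ((Q ^\<^sub>m i) $$ (s, u))" for i
    unfolding of_real_hom.mat_hom_pow[OF Q, symmetric] using carrier_matD[OF pow_carrier_mat[OF Q, of i]] su by simp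
  then show "map_mat complex_of_real (poly_mat p Q) $$ (s, u) =
      poly_mat (map_poly of_real p) (map_mat of_real Q) $$ (s, u)"
    using su Q by (simp add: poly_mat_def)
qed (use Q in \<open>auto simp: poly_mat_def\<close>)

lemma vec_block_block_vec:
  assumes "f j \<in> carrier_vec M" "j < m"
  shows "vec_block M (block_vec m M f) j = f j"
proof (rule eq_vecI)
  fix s assume "s < dim_vec (f j)"
  then have s: "s < M" using assms by simp
  have "j * M + s < j * M + M" using s by simp
  also have "\<dots> \<le> m * M" using assms mult_le_mono1[of "Suc j" m M] by simp
  finally show "vec_block M (block_vec m M f) j $ s = f j $ s"
    using s by (simp add: vec_block_def block_vec_def)
qed (use assms in \<open>simp add: vec_block_def\<close>)

lemma map_vec_vec_block:
  assumes "X \<in> carrier_vec (m * M)" "j < m"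
  shows "map_vec f (vec_block M X j) = vec_block M (map_vec f X) j"
proof (rule eq_vecI)
  fix s assume "s < dim_vec (vec_block M (map_vec f X) j)"
  then have s: "s < M" by (simp add: vec_block_def)
  have "j * M + s < j * M + M" using s by simp
  also have "\<dots> \<le> m * M" using assms mult_le_mono1[of "Suc j" m M] by simp
  finally show "map_vec f (vec_block M X j) $ s = vec_block M (map_vec f X) j $ s"
    using s assms by (simp add: vec_block_def)
qed (simp add: vec_block_def)

lemma vec_eq_0_if_blocks_0:
  assumes X: "X \<in> carrier_vec (m * M)" and blocks: "\<And>j. j < m \<Longrightarrow> vec_block M X j = 0\<^sub>v M"
  shows "X = 0\<^sub>v (m * M)"
proof (rule eq_vecI)
  fix l assume "l < dim_vec (0\<^sub>v (m * M) :: 'a vec)"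
  then have l: "l < m * M" by simp
  then have "M > 0" by (cases M) auto
  then have "l mod M < M" "l div M < m" using l by (simp_all add: less_mult_imp_div_less)
  then have "vec_block M X (l div M) $ (l mod M) = 0" using blocks by simp
  then show "X $ l = (0\<^sub>v (m * M)) $ l" using l \<open>l mod M < M\<close> by (simp add: vec_block_def)
qed (use X in simp)

section \<open>The partial fraction formula\<close>

lemma minus_one_power_mult_poly: "(- 1) ^ m * p = smult ((- 1) ^ m) p" for p :: "'a::comm_ring_1 poly"
  by (cases "even m") simp_all

text \<open>Interpolation at the zeros -\<zeta> j of \<open>phi r\<close>. The minus sign before the
  sum, which later becomes the additional +1 in the exponent of the sign, stems from the derivative
  of \<open>phi r\<close> at -\<zeta> j being -P_r'(\<zeta> j).\<close>

lemma phi_minor_partial_fractions: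
  fixes \<zeta> :: "nat \<Rightarrow> complex"
  assumes r: "1 \<le> r" and zeros: "\<zeta> ` {1..r} = {z. poly (pade_num r) z = 0}"
    and k: "k \<in> {1..r + 1}" and i: "i \<in> {1..r + 1}"
  shows "phi_minor r k i = smult (if k = r + 1 \<and> i = r + 1 then (- 1) ^ r else 0) (phi r) -
    (\<Sum>j\<in>{1..r}. smult (poly (phi_minor r k i) (- \<zeta> j) / poly (pderiv (pade_num r)) (\<zeta> j))
      (phi r div [:\<zeta> j, 1:]))"
proof -
  let ?c = "if k = r + 1 \<and> i = r + 1 then (- 1) ^ r else 0 :: complex"
  let ?\<phi> = "phi r :: complex poly"
  \<comment> \<open>Subtracting the value at infinity makes the fraction proper and leaves the
    values at the zeros of \<open>phi r\<close> unchanged.\<close>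
  define q where "q = phi_minor r k i - smult ?c ?\<phi>"
  define S where "S = (\<lambda>j. - \<zeta> j) ` {1..r}"
  have r0: "r \<noteq> 0" using r by simp
  have "card (\<zeta> ` {1..r}) = card {1..r}"
    unfolding zeros card_pade_num_zeros by (rule card_atLeastAtMost[THEN trans, symmetric]) simp
  with finite_atLeastAtMost have "inj_on \<zeta> {1..r}" by (rule eq_card_imp_inj_on)
  then have inj: "inj_on (\<lambda>j. - \<zeta> j) {1..r}"
    by (intro inj_onI) (drule inj_onD, simp_all)
  then have card: "card S = r" unfolding S_def by (simp add: card_image)
  have root: "poly ?\<phi> x = 0" "poly (pderiv ?\<phi>) x \<noteq> 0" if "x \<in> S" for x
  proof -
    have "- x \<in> \<zeta> ` {1..r}" using that by (auto simp: S_def)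
    then have "poly (pade_num r) (- x) = 0" unfolding zeros by simp
    then show "poly ?\<phi> x = 0" "poly (pderiv ?\<phi>) x \<noteq> 0"
      using pade_num_simple_zero by (simp_all add: poly_phi[OF r0] poly_pderiv_phi[OF r0])
  qed
  have factor: "?\<phi> = [:- x, 1:] * (?\<phi> div [:- x, 1:])" if "x \<in> S" for x
    using root(1)[OF that] unfolding poly_eq_0_iff_dvd by (metis dvd_mult_div_cancel)
  have deg: "degree (?\<phi> div [:- x, 1:]) < card S" if "x \<in> S" for x
  proof -
    have "?\<phi> div [:- x, 1:] \<noteq> 0" using factor[OF that] degree_phi[OF r0, where 'a=complex] r0
      by (metis degree_0 mult_zero_right)
    then have "degree ?\<phi> = 1 + degree (?\<phi> div [:- x, 1:])"
      by (subst factor[OF that], subst degree_mult_eq) auto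
    then show ?thesis using degree_phi[OF r0, where 'a=complex] card by simp
  qed
  have "degree q < card S"
    using degree_phi_minor[OF r k i, where 'a=complex] degree_phi_minor_last[OF r, where 'a=complex]
    unfolding q_def card minus_one_power_mult_poly by auto
  from partial_fraction_interpolation[OF _ this factor deg root(2)]
  have "q = (\<Sum>x\<in>S. smult (poly q x / poly (pderiv ?\<phi>) x) (?\<phi> div [:- x, 1:]))"
    by (simp add: S_def)
  also have "\<dots> = (\<Sum>x\<in>S. smult (poly (phi_minor r k i) x / poly (pderiv ?\<phi>) x) (?\<phi> div [:- x, 1:]))"
    using root(1) by (intro sum.cong) (simp_all add: q_def)
  also have "\<dots> = (\<Sum>j\<in>{1..r}. smult (poly (phi_minor r k i) (- \<zeta> j) / - poly (pderiv (pade_num r)) (\<zeta> j))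
      (?\<phi> div [:\<zeta> j, 1:]))"
    unfolding S_def sum.reindex[OF inj] by (simp add: poly_pderiv_phi[OF r0])
  finally show ?thesis unfolding q_def by (simp add: sum_negf algebra_simps)
qed

text \<open>The two occurrences of \<open>E_mat r\<close> are its real and its complex instance. All
  coefficients are rational, hence preserved by the embedding.\<close>

lemma map_poly_E_mat: "map_mat (map_poly complex_of_real) (E_mat r) = E_mat r"
proof (rule eq_matI)
  interpret map_poly_comm_ring_hom complex_of_real ..
  have c: "map_poly complex_of_real (c_entry k) = c_entry k" for k
    by (cases "even k") (simp_all add: c_entry_def hom_distribs)
  fix p q assume "p < dim_row (E_mat r :: complex poly mat)" "q < dim_col (E_mat r :: complex poly mat)"
  then show "map_mat (map_poly complex_of_real) (E_mat r) $$ (p, q) = E_mat r $$ (p, q)"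
    by (auto simp: E_mat_def Let_def c a_entry_def b_entry_def map_poly_monom hom_distribs)
qed (simp_all add: E_mat_def)

lemma map_poly_phi: "map_poly complex_of_real (phi r) = phi r"
proof -
  interpret map_poly_comm_ring_hom complex_of_real ..
  show ?thesis unfolding phi_def hom_det[symmetric] map_poly_E_mat ..
qed

lemma map_mat_poly_block_mat:
  assumes Q: "Q \<in> carrier_mat n n"
  shows "map_mat complex_of_real (poly_block_mat E Q) =
    poly_block_mat (map_mat (map_poly of_real) E) (map_mat of_real Q)"
proof (rule eq_matI)
  fix p q
  assume "p < dim_row (poly_block_mat (map_mat (map_poly complex_of_real) E) (map_mat of_real Q))"
    "q < dim_col (poly_block_mat (map_mat (map_poly complex_of_real) E) (map_mat of_real Q))"
  then have pq: "p < dim_row E * n" "q < dim_col E * n" using Q by (simp_all add: poly_block_mat_def Let_def)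
  then have "n > 0" by (cases n) auto
  then have bounds: "p div n < dim_row E" "q div n < dim_col E" "p mod n < n" "q mod n < n"
    using pq by (simp_all add: less_mult_imp_div_less)
  have "complex_of_real (poly_mat (E $$ (p div n, q div n)) Q $$ (p mod n, q mod n)) =
      map_mat complex_of_real (poly_mat (E $$ (p div n, q div n)) Q) $$ (p mod n, q mod n)"
    using bounds Q by (simp add: poly_mat_def)
  also have "\<dots> = poly_mat (map_poly of_real (E $$ (p div n, q div n))) (map_mat of_real Q) $$ (p mod n, q mod n)"
    by (simp only: map_mat_poly_mat[OF Q])
  finally show "map_mat complex_of_real (poly_block_mat E Q) $$ (p, q) =
    poly_block_mat (map_mat (map_poly of_real) E) (map_mat of_real Q) $$ (p, q)"
    using pq bounds Q by (simp add: poly_block_mat_def Let_def)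
qed (use Q in \<open>simp_all add: poly_block_mat_def Let_def\<close>)

lemma quadratic_form_symmetric_part:
  fixes D :: "real mat"
  assumes D: "D \<in> carrier_mat n n" and x: "x \<in> carrier_vec n"
  shows "x \<bullet> ((D + transpose_mat D) *\<^sub>v x) = 2 * (x \<bullet> (D *\<^sub>v x))"
proof -
  have Dx: "D *\<^sub>v x \<in> carrier_vec n" "transpose_mat D *\<^sub>v x \<in> carrier_vec n" using D x by auto
  have "(D + transpose_mat D) *\<^sub>v x = D *\<^sub>v x + transpose_mat D *\<^sub>v x"
    using D x by (intro add_mult_distrib_mat_vec[of _ n n]) auto
  moreover have "x \<bullet> (transpose_mat D *\<^sub>v x) = x \<bullet> (D *\<^sub>v x)"
    using transpose_vec_mult_scalar[OF D x x] comm_scalar_prod[OF x Dx(2)] by simp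
  ultimately show ?thesis using x Dx by (simp add: scalar_prod_add_distrib[of _ n])
qed

lemma rhs_block_carrier:
  assumes "\<forall>k<r. R k \<in> carrier_vec M" "Y \<in> carrier_vec M" "m \<le> r"
  shows "rhs_block r \<tau> R Y m \<in> carrier_vec M"
  using assms by (auto simp: rhs_block_def Let_def)

lemma vec_eq_if_diff_eq_0:
  fixes v w :: "'a::ab_group_add vec"
  assumes v: "v \<in> carrier_vec n" and w: "w \<in> carrier_vec n" and diff: "v - w = 0\<^sub>v n"
  shows "v = w"
proof (rule eq_vecI)
  fix s assume "s < dim_vec w"
  then show "v $ s = w $ s" using arg_cong[OF diff, of "\<lambda>x. x $ s"] w by simp
qed (use v w in simp)

text \<open>After \<open>phi r\<close> at Q is applied, Cramer's rule gives cofactors on the left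
  and \<open>mult_mat_inv_vec\<close> gives the quotients \<psi> j on the right; they match by the
  polynomial identity \<open>phi_minor_partial_fractions\<close>.\<close>

lemma partial_fraction_solution:
  fixes Q :: "complex mat" and \<zeta> :: "nat \<Rightarrow> complex"
  assumes Q: "Q \<in> carrier_mat M M" and r: "1 \<le> r"
    and zeros: "\<zeta> ` {1..r} = {z. poly (pade_num r) z = 0}"
    and inv: "\<And>j. j \<in> {1..r} \<Longrightarrow> invertible_mat (\<zeta> j \<cdot>\<^sub>m 1\<^sub>m M + Q)"
    and inj: "\<And>v. v \<in> carrier_vec M \<Longrightarrow> poly_mat (phi r) Q *\<^sub>v v = 0\<^sub>v M \<Longrightarrow> v = 0\<^sub>v M"
    and X: "X \<in> carrier_vec ((r + 1) * M)"
    and b: "\<And>k. k \<le> r \<Longrightarrow> b k \<in> carrier_vec M"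
    and sys: "\<And>k. k \<le> r \<Longrightarrow> vec_block M (poly_block_mat (E_mat r) Q *\<^sub>v X) k = b k"
    and i: "i \<in> {1..r + 1}"
  shows "vec_block M X (i - 1) =
     ((- 1) ^ r * (if i = r + 1 then 1 else 0)) \<cdot>\<^sub>v b r
     + finsum_vec TYPE(complex) M
         (\<lambda>j. mat_inv (\<zeta> j \<cdot>\<^sub>m 1\<^sub>m M + Q) *\<^sub>v
            finsum_vec TYPE(complex) M
              (\<lambda>k. ((- 1) ^ (i + k + 1) * (poly (phi_minor r k i) (- \<zeta> j)
                       / poly (pderiv (pade_num r)) (\<zeta> j))) \<cdot>\<^sub>v b (k - 1))
              {1..r + 1})
         {1..r}" (is "?a = ?u + ?w")
proof -
  let ?\<phi> = "phi r :: complex poly"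
  define \<psi> where "\<psi> j = ?\<phi> div [:\<zeta> j, 1:]" for j
  define coef where "coef k j = (- 1) ^ (i + k + 1) * (poly (phi_minor r k i) (- \<zeta> j)
                       / poly (pderiv (pade_num r)) (\<zeta> j))" for k j
  define c where "c k = (if k = r + 1 \<and> i = r + 1 then (- 1) ^ r else 0 :: complex)" for k
  define g where "g j = finsum_vec TYPE(complex) M (\<lambda>k. coef k j \<cdot>\<^sub>v b (k - 1)) {1..r + 1}" for j
  define h where "h j = mat_inv (\<zeta> j \<cdot>\<^sub>m 1\<^sub>m M + Q) *\<^sub>v g j" for j
  have r0: "r \<noteq> 0" using r by simp
  note P = poly_mat_carrier[OF Q]
  have b': "b (k - 1) \<in> carrier_vec M" if "k \<in> {1..r + 1}" for k using b that by auto
  have g: "g j \<in> carrier_vec M" for j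
    unfolding g_def by (rule finsum_vec_closed) (use b' in auto)
  have \<psi>: "?\<phi> = [:\<zeta> j, 1:] * \<psi> j" if "j \<in> {1..r}" for j
  proof -
    have "poly (pade_num r) (\<zeta> j) = 0" using zeros that by blast
    then have "[:\<zeta> j, 1:] dvd ?\<phi>"
      using poly_eq_0_iff_dvd[of ?\<phi> "- \<zeta> j"] by (simp add: poly_phi[OF r0])
    then show ?thesis unfolding \<psi>_def by (simp only: dvd_mult_div_cancel)
  qed
  have h: "h j \<in> carrier_vec M" "poly_mat ?\<phi> Q *\<^sub>v h j = poly_mat (\<psi> j) Q *\<^sub>v g j" if "j \<in> {1..r}" for j
    using mult_mat_inv_vec[OF Q inv[OF that] \<psi>[OF that] g] unfolding h_def by auto
  have w: "?w = finsum_vec TYPE(complex) M h {1..r}" unfolding h_def g_def coef_def ..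
  have u_cl: "?u \<in> carrier_vec M" using b by simp
  have w_cl: "?w \<in> carrier_vec M" unfolding w by (rule finsum_vec_closed) (use h in auto)
  have a_cl: "?a \<in> carrier_vec M" by (simp add: vec_block_def)
  have eq: "poly_mat ?\<phi> Q *\<^sub>v ?a = poly_mat ?\<phi> Q *\<^sub>v (?u + ?w)"
  proof (rule eq_vecI)
    fix s assume "s < dim_vec (poly_mat ?\<phi> Q *\<^sub>v (?u + ?w))"
    then have s: "s < M" using carrier_matD(1)[OF P] by simp
    \<comment> \<open>A fixed component of p(Q) v is a scalar linear in p, which reduces the
      comparison to finite sums of complex numbers.\<close>
    define L where "L p v = (poly_mat p Q *\<^sub>v v) $ s" for p and v :: "complex vec"
    have dim: "dim_vec (poly_mat p Q *\<^sub>v v) = M" for p and v :: "complex vec"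
      using carrier_matD(1)[OF P] by simp
    have L_add: "L (p + q) v = L p v + L q v" if "v \<in> carrier_vec M" for p q v
      using s dim by (simp add: L_def poly_mat_vec_add[OF Q that] del: index_mult_mat_vec dim_mult_mat_vec)
    have L_smult: "L (smult x p) v = x * L p v" if "v \<in> carrier_vec M" for x p v
      using s dim by (simp add: L_def poly_mat_vec_smult[OF Q that] del: index_mult_mat_vec dim_mult_mat_vec)
    have "(poly_mat ?\<phi> Q *\<^sub>v ?a) $ s = (\<Sum>p<r + 1. L (cofactor (E_mat r) p (i - 1)) (b p))"
    proof -
      have "poly_mat ?\<phi> Q *\<^sub>v ?a = finsum_vec TYPE(complex) M
          (\<lambda>p. poly_mat (cofactor (E_mat r) p (i - 1)) Q *\<^sub>v vec_block M (poly_block_mat (E_mat r) Q *\<^sub>v X) p) {..<r + 1}"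
        unfolding phi_def using i by (intro poly_block_mat_cramer[OF Q E_mat_carrier X]) auto
      also have "\<dots> $ s = (\<Sum>p<r + 1. L (cofactor (E_mat r) p (i - 1))
          (vec_block M (poly_block_mat (E_mat r) Q *\<^sub>v X) p))"
        unfolding L_def using s Q by (intro index_finsum_vec) (auto simp: vec_block_def)
      finally show ?thesis using sys by simp
    qed
    also have "\<dots> = (\<Sum>k\<in>{1..r + 1}. (- 1) ^ (i + k) * L (phi_minor r k i) (b (k - 1)))"
    proof (rule sum.reindex_bij_witness[of _ "\<lambda>k. k - 1" Suc])
      fix p assume "p \<in> {..<r + 1}"
      then have "L (cofactor (E_mat r) p (i - 1)) (b p) = (- 1) ^ (p + (i - 1)) * L (phi_minor r (Suc p) i) (b p)"
        unfolding cofactor_def phi_minor_def minus_one_power_mult_poly using b by (simp add: L_smult)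
      \<comment> \<open>Zero-based cofactor indices lower the exponent i + k by two, which preserves
        the sign.\<close>
      moreover have "(- 1 :: complex) ^ (p + (i - 1)) = (- 1) ^ (i + Suc p)" using i by (cases i) (auto simp: add.commute)
      ultimately show "(- 1) ^ (i + Suc p) * L (phi_minor r (Suc p) i) (b (Suc p - 1)) =
          L (cofactor (E_mat r) p (i - 1)) (b p)" by simp
    qed auto
    also have "\<dots> = (\<Sum>k\<in>{1..r + 1}. (- 1) ^ (i + k) * (c k * L ?\<phi> (b (k - 1)))
        + (\<Sum>j\<in>{1..r}. coef k j * L (\<psi> j) (b (k - 1))))"
    proof (rule sum.cong[OF refl])
      fix k assume k: "k \<in> {1..r + 1}"
      have "smult ((- 1) ^ (i + k)) (phi_minor r k i) =
          smult ((- 1) ^ (i + k) * c k) ?\<phi> + (\<Sum>j\<in>{1..r}. smult (coef k j) (\<psi> j))"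
        using arg_cong[OF phi_minor_partial_fractions[OF r zeros k i], of "smult ((- 1) ^ (i + k))"]
        unfolding c_def[symmetric] \<psi>_def[symmetric] coef_def
        by (simp add: smult_diff_right smult_sum2 sum_negf[symmetric])
      then have "L (smult ((- 1) ^ (i + k)) (phi_minor r k i)) (b (k - 1)) =
         L (smult ((- 1) ^ (i + k) * c k) ?\<phi>) (b (k - 1)) + L (\<Sum>j\<in>{1..r}. smult (coef k j) (\<psi> j)) (b (k - 1))"
        by (simp only: L_add[OF b'[OF k]])
      also have "L (\<Sum>j\<in>{1..r}. smult (coef k j) (\<psi> j)) (b (k - 1)) =
          (\<Sum>j\<in>{1..r}. coef k j * L (\<psi> j) (b (k - 1)))"
        unfolding L_smult[OF b'[OF k], symmetric] unfolding L_def by (rule poly_mat_vec_sum[OF Q b'[OF k] s])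
      finally show "(- 1) ^ (i + k) * L (phi_minor r k i) (b (k - 1)) =
         (- 1) ^ (i + k) * (c k * L ?\<phi> (b (k - 1))) + (\<Sum>j\<in>{1..r}. coef k j * L (\<psi> j) (b (k - 1)))"
        by (simp only: L_smult[OF b'[OF k]] mult.assoc)
    qed
    also have "\<dots> = (\<Sum>k\<in>{1..r + 1}. (- 1) ^ (i + k) * (c k * L ?\<phi> (b (k - 1))))
        + (\<Sum>j\<in>{1..r}. \<Sum>k\<in>{1..r + 1}. coef k j * L (\<psi> j) (b (k - 1)))"
      unfolding sum.distrib by (subst sum.swap) simp
    \<comment> \<open>Only k = i = r + 1 can survive, and there i + k is even.\<close>
    also have "(\<Sum>k\<in>{1..r + 1}. (- 1) ^ (i + k) * (c k * L ?\<phi> (b (k - 1)))) =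
       (\<Sum>k\<in>{1..r + 1}. if k = r + 1 then (- 1) ^ r * (if i = r + 1 then 1 else 0) * L ?\<phi> (b r) else 0)"
      by (intro sum.cong[OF refl]) (auto simp: c_def)
    also have "\<dots> = (- 1) ^ r * (if i = r + 1 then 1 else 0) * L ?\<phi> (b r)"
      by (subst sum.delta) auto
    also have "\<dots> = (poly_mat ?\<phi> Q *\<^sub>v ?u) $ s"
      using s dim b by (simp add: L_def mult_mat_vec[OF P] del: index_mult_mat_vec dim_mult_mat_vec)
    also have "(\<Sum>j\<in>{1..r}. \<Sum>k\<in>{1..r + 1}. coef k j * L (\<psi> j) (b (k - 1))) =
       (\<Sum>j\<in>{1..r}. (poly_mat ?\<phi> Q *\<^sub>v h j) $ s)"
    proof (rule sum.cong[OF refl])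
      fix j assume j: "j \<in> {1..r}"
      have "poly_mat (\<psi> j) Q *\<^sub>v g j =
          finsum_vec TYPE(complex) M (\<lambda>k. poly_mat (\<psi> j) Q *\<^sub>v (coef k j \<cdot>\<^sub>v b (k - 1))) {1..r + 1}"
        unfolding g_def by (rule mult_mat_finsum_vec[OF P]) (use b' in auto)
      also have "\<dots> $ s = (\<Sum>k\<in>{1..r + 1}. (poly_mat (\<psi> j) Q *\<^sub>v (coef k j \<cdot>\<^sub>v b (k - 1))) $ s)"
        using s b' Q by (intro index_finsum_vec) auto
      also have "\<dots> = (\<Sum>k\<in>{1..r + 1}. coef k j * L (\<psi> j) (b (k - 1)))"
        using s dim b' by (intro sum.cong[OF refl])
          (simp add: L_def mult_mat_vec[OF P] del: index_mult_mat_vec dim_mult_mat_vec)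
      finally show "(\<Sum>k\<in>{1..r + 1}. coef k j * L (\<psi> j) (b (k - 1))) = (poly_mat ?\<phi> Q *\<^sub>v h j) $ s"
        unfolding h(2)[OF j] by simp
    qed
    also have "\<dots> = (poly_mat ?\<phi> Q *\<^sub>v ?w) $ s"
    proof -
      have "poly_mat ?\<phi> Q *\<^sub>v ?w = finsum_vec TYPE(complex) M (\<lambda>j. poly_mat ?\<phi> Q *\<^sub>v h j) {1..r}"
        unfolding w by (rule mult_mat_finsum_vec[OF P]) (use h in auto)
      also have "\<dots> $ s = (\<Sum>j\<in>{1..r}. (poly_mat ?\<phi> Q *\<^sub>v h j) $ s)"
        using s h(1) Q by (intro index_finsum_vec) auto
      finally show ?thesis by simp
    qed
    also have "(poly_mat ?\<phi> Q *\<^sub>v ?u) $ s + (poly_mat ?\<phi> Q *\<^sub>v ?w) $ s = (poly_mat ?\<phi> Q *\<^sub>v (?u + ?w)) $ s"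
      unfolding mult_add_distrib_mat_vec[OF P u_cl w_cl]
      using s dim by (simp del: index_mult_mat_vec dim_mult_mat_vec)
    finally show "(poly_mat ?\<phi> Q *\<^sub>v ?a) $ s = (poly_mat ?\<phi> Q *\<^sub>v (?u + ?w)) $ s" .
  qed simp
  have uw_cl: "?u + ?w \<in> carrier_vec M" using u_cl w_cl by simp
  have "poly_mat ?\<phi> Q *\<^sub>v (?a - (?u + ?w)) = 0\<^sub>v M"
    unfolding mult_minus_distrib_mat_vec[OF P a_cl uw_cl] eq
    by (rule minus_cancel_vec) (rule mult_mat_vec_carrier[OF P uw_cl])
  then have "?a - (?u + ?w) = 0\<^sub>v M" by (rule inj[rotated]) (use a_cl uw_cl in simp)
  from vec_eq_if_diff_eq_0[OF a_cl uw_cl this] show ?thesis .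
qed

text \<open>Unique solvability and the invertibility of the shifted matrices belong to the
  conclusion because they give meaning to "the solution" and to \<open>mat_inv\<close>. The zeros
  are complex, so the formula is stated for the images of the real blocks under the
  embedding.\<close>

theorem theorem3p1:
  fixes r n N M :: nat
    and T \<tau> :: real
    and t :: "nat \<Rightarrow> real"
    and D A :: "real mat"
    and R b :: "nat \<Rightarrow> real vec"
    and Y B :: "real vec"
    and \<zeta> :: "nat \<Rightarrow> complex"
  assumes r: "1 \<le> r"
    and partition: "t 0 = 0" "t N = T" "\<forall>m<N. t m < t (Suc m)"
    and n: "n < N"
    and tau: "\<tau> = t (Suc n) - t n"
    and D: "D \<in> carrier_mat M M" "neg_semidefinite (D + transpose_mat D)"
    and R: "\<forall>k<r. R k \<in> carrier_vec M"
    and Y: "Y \<in> carrier_vec M"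
    and A: "A = poly_block_mat (E_mat r) (\<tau> \<cdot>\<^sub>m D)"
    and b: "b = rhs_block r \<tau> R Y"
    and B: "B = block_vec (r + 1) M b"
    and zeros: "\<zeta> ` {1..r} = {z. poly (pade_num r) z = 0}"
  shows "invertible_mat (poly_mat (phi r) (\<tau> \<cdot>\<^sub>m D))
    \<and> (\<exists>!X. X \<in> carrier_vec ((r + 1) * M) \<and> A *\<^sub>v X = B)
    \<and> (\<forall>j\<in>{1..r}. invertible_mat
          (\<zeta> j \<cdot>\<^sub>m 1\<^sub>m M + map_mat complex_of_real (\<tau> \<cdot>\<^sub>m D)))
    \<and> (\<forall>X \<in> carrier_vec ((r + 1) * M). A *\<^sub>v X = B \<longrightarrow>
        (\<forall>i\<in>{1..r + 1}.
          map_vec complex_of_real (vec_block M X (i - 1)) =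
            ((- 1) ^ r * (if i = r + 1 then 1 else 0)) \<cdot>\<^sub>v map_vec complex_of_real (b r)
            + finsum_vec TYPE(complex) M
                (\<lambda>j. mat_inv (\<zeta> j \<cdot>\<^sub>m 1\<^sub>m M + map_mat complex_of_real (\<tau> \<cdot>\<^sub>m D)) *\<^sub>v
                   finsum_vec TYPE(complex) M
                     (\<lambda>k. ((- 1) ^ (i + k + 1) * (poly (phi_minor r k i) (- \<zeta> j)
                              / poly (pderiv (pade_num r)) (\<zeta> j)))
                          \<cdot>\<^sub>v map_vec complex_of_real (b (k - 1)))
                     {1..r + 1})
                {1..r}))"
proof -
  let ?\<phi> = "phi r :: complex poly"
  define Q where "Q = \<tau> \<cdot>\<^sub>m D"
  define cQ where "cQ = map_mat complex_of_real Q"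
  have Q: "Q \<in> carrier_mat M M" using D by (simp add: Q_def)
  have cQ: "cQ \<in> carrier_mat M M" using Q by (simp add: cQ_def)
  have r0: "r \<noteq> 0" using r by simp
  have tau_pos: "\<tau> > 0" using partition n tau by simp
  have diss: "x \<bullet> (Q *\<^sub>v x) \<le> 0" if x: "x \<in> carrier_vec M" for x
  proof -
    have "x \<bullet> ((D + transpose_mat D) *\<^sub>v x) \<le> 0"
      using D x unfolding neg_semidefinite_def by auto
    then have "x \<bullet> (D *\<^sub>v x) \<le> 0" by (simp add: quadratic_form_symmetric_part[OF D(1) x])
    moreover have "x \<bullet> (Q *\<^sub>v x) = \<tau> * (x \<bullet> (D *\<^sub>v x))"
      unfolding Q_def using D(1) x by (simp add: smult_mat_mult_vec[OF D(1) x])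
    ultimately show ?thesis using tau_pos by (simp add: mult_nonneg_nonpos)
  qed
  have shift_inj: "v = 0\<^sub>v M"
    if "poly (pade_num r) z = 0" "v \<in> carrier_vec M" "(z \<cdot>\<^sub>m 1\<^sub>m M + cQ) *\<^sub>v v = 0\<^sub>v M" for z v
    using shifted_dissipative_injective[OF Q diss Re_pade_num_zero[OF that(1)] that(2)] that(3)
    unfolding cQ_def by blast
  have "?\<phi> \<noteq> 0" using degree_phi[OF r0, where 'a=complex] r0 by auto
  then have phi_inj: "v = 0\<^sub>v M" if "v \<in> carrier_vec M" "poly_mat ?\<phi> cQ *\<^sub>v v = 0\<^sub>v M" for v
    using poly_mat_vec_injective[OF cQ _ _ that] shift_inj by (simp add: poly_phi[OF r0])
  have part1: "invertible_mat (poly_mat (phi r) Q)"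
  proof (rule invertible_mat_if_injective[OF poly_mat_carrier[OF Q]])
    fix v assume v: "v \<in> carrier_vec M" "poly_mat (phi r) Q *\<^sub>v v = 0\<^sub>v M"
    have "poly_mat ?\<phi> cQ *\<^sub>v map_vec complex_of_real v = map_vec complex_of_real (poly_mat (phi r) Q *\<^sub>v v)"
      unfolding of_real_hom.mult_mat_vec_hom[OF poly_mat_carrier[OF Q] v(1)] map_mat_poly_mat[OF Q]
        map_poly_phi cQ_def ..
    also have "\<dots> = 0\<^sub>v M" unfolding v(2) by (rule of_real_hom.vec_hom_zero)
    finally have "map_vec complex_of_real v = 0\<^sub>v M" by (rule phi_inj[rotated]) (use v(1) in simp)
    then show "v = 0\<^sub>v M" by simp
  qed
  have part3: "invertible_mat (\<zeta> j \<cdot>\<^sub>m 1\<^sub>m M + cQ)" if "j \<in> {1..r}" for j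
  proof (rule invertible_mat_if_injective)
    show "\<zeta> j \<cdot>\<^sub>m 1\<^sub>m M + cQ \<in> carrier_mat M M" using cQ by simp
    have "poly (pade_num r) (\<zeta> j) = 0" using zeros that by blast
    then show "\<And>v. v \<in> carrier_vec M \<Longrightarrow> (\<zeta> j \<cdot>\<^sub>m 1\<^sub>m M + cQ) *\<^sub>v v = 0\<^sub>v M \<Longrightarrow> v = 0\<^sub>v M"
      by (rule shift_inj)
  qed
  have A_cl: "A \<in> carrier_mat ((r + 1) * M) ((r + 1) * M)"
    unfolding A Q_def[symmetric] using Q E_mat_carrier[of r, where 'a=real]
    by (simp add: poly_block_mat_def Let_def)
  have mapA: "poly_block_mat (E_mat r) cQ *\<^sub>v map_vec complex_of_real X = map_vec complex_of_real (A *\<^sub>v X)"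
    if "X \<in> carrier_vec ((r + 1) * M)" for X
    unfolding of_real_hom.mult_mat_vec_hom[OF A_cl that]
    unfolding A Q_def[symmetric] map_mat_poly_block_mat[OF Q] map_poly_E_mat cQ_def ..
  have part2: "\<exists>!X. X \<in> carrier_vec ((r + 1) * M) \<and> A *\<^sub>v X = B"
  proof (rule ex1_solution_if_invertible[OF A_cl])
    show "B \<in> carrier_vec ((r + 1) * M)" by (simp add: B block_vec_def)
    show "invertible_mat A"
    proof (rule invertible_mat_if_injective[OF A_cl])
      fix X assume X: "X \<in> carrier_vec ((r + 1) * M)" and AX: "A *\<^sub>v X = 0\<^sub>v ((r + 1) * M)"
      let ?X = "map_vec complex_of_real X"
      have cX: "?X \<in> carrier_vec ((r + 1) * M)" using X by simp
      show "X = 0\<^sub>v ((r + 1) * M)"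
      proof (rule vec_eq_0_if_blocks_0[OF X])
        fix i assume i: "i < r + 1"
        have zero: "vec_block M (poly_block_mat (E_mat r) cQ *\<^sub>v ?X) p = 0\<^sub>v M" if "p \<in> {..<r + 1}" for p
        proof -
          have "vec_block M (map_vec complex_of_real (A *\<^sub>v X)) p = map_vec of_real (vec_block M (A *\<^sub>v X) p)"
            using A_cl X that by (intro map_vec_vec_block[symmetric]) auto
          also have "vec_block M (A *\<^sub>v X) p = 0\<^sub>v M"
          proof (rule eq_vecI)
            fix s assume "s < dim_vec (0\<^sub>v M :: real vec)"
            then have "p * M + s < p * M + M" by simp
            also have "\<dots> \<le> (r + 1) * M" using that mult_le_mono1[of "Suc p" "r + 1" M] by simp
            finally show "vec_block M (A *\<^sub>v X) p $ s = 0\<^sub>v M $ s"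
              unfolding AX using \<open>s < _\<close> by (simp add: vec_block_def)
          qed (simp add: vec_block_def)
          finally show ?thesis unfolding mapA[OF X] by (simp add: of_real_hom.vec_hom_zero)
        qed
        \<comment> \<open>With zero right-hand side, Cramer's rule puts every block of a kernel
          vector into the kernel of \<open>phi r\<close> at \<open>cQ\<close>, which is
          trivial.\<close>
        have "poly_mat ?\<phi> cQ *\<^sub>v vec_block M ?X i = finsum_vec TYPE(complex) M
          (\<lambda>p. poly_mat (cofactor (E_mat r) p i) cQ *\<^sub>v vec_block M (poly_block_mat (E_mat r) cQ *\<^sub>v ?X) p) {..<r + 1}"
          unfolding phi_def by (rule poly_block_mat_cramer[OF cQ E_mat_carrier cX i])
        also have "\<dots> = 0\<^sub>v M"
        proof (rule eq_vecI)
          have cl: "(\<lambda>p. poly_mat (cofactor (E_mat r) p i) cQ *\<^sub>v vec_block M (poly_block_mat (E_mat r) cQ *\<^sub>v ?X) p)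
              \<in> {..<r + 1} \<rightarrow> carrier_vec M"
            using cQ by (auto simp: vec_block_def)
          then show "dim_vec (finsum_vec TYPE(complex) M
            (\<lambda>p. poly_mat (cofactor (E_mat r) p i) cQ *\<^sub>v vec_block M (poly_block_mat (E_mat r) cQ *\<^sub>v ?X) p) {..<r + 1})
             = dim_vec (0\<^sub>v M :: complex vec)"
            using finsum_vec_closed[OF cl] by simp
          fix s assume "s < dim_vec (0\<^sub>v M :: complex vec)"
          then show "finsum_vec TYPE(complex) M
            (\<lambda>p. poly_mat (cofactor (E_mat r) p i) cQ *\<^sub>v vec_block M (poly_block_mat (E_mat r) cQ *\<^sub>v ?X) p) {..<r + 1} $ s
             = 0\<^sub>v M $ s"
            using zero mult_mat_zero_vec[OF poly_mat_carrier[OF cQ]]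
            by (subst index_finsum_vec[OF _ _ cl]) (simp_all del: index_mult_mat_vec)
        qed
        finally have "vec_block M ?X i = 0\<^sub>v M" by (rule phi_inj[rotated]) (simp add: vec_block_def)
        then have "map_vec complex_of_real (vec_block M X i) = 0\<^sub>v M"
          using map_vec_vec_block[OF X i, of complex_of_real] by simp
        then show "vec_block M X i = 0\<^sub>v M" by simp
      qed
    qed
  qed
  have b_cl: "b k \<in> carrier_vec M" if "k \<le> r" for k
    unfolding b by (rule rhs_block_carrier[OF R Y that])
  have part4: "map_vec complex_of_real (vec_block M X (i - 1)) =
            ((- 1) ^ r * (if i = r + 1 then 1 else 0)) \<cdot>\<^sub>v map_vec complex_of_real (b r)
            + finsum_vec TYPE(complex) M
                (\<lambda>j. mat_inv (\<zeta> j \<cdot>\<^sub>m 1\<^sub>m M + cQ) *\<^sub>v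
                   finsum_vec TYPE(complex) M
                     (\<lambda>k. ((- 1) ^ (i + k + 1) * (poly (phi_minor r k i) (- \<zeta> j)
                              / poly (pderiv (pade_num r)) (\<zeta> j)))
                          \<cdot>\<^sub>v map_vec complex_of_real (b (k - 1)))
                     {1..r + 1})
                {1..r}"
    if X: "X \<in> carrier_vec ((r + 1) * M)" "A *\<^sub>v X = B" and i: "i \<in> {1..r + 1}" for X i
  proof -
    have B_cl: "B \<in> carrier_vec ((r + 1) * M)" by (simp add: B block_vec_def)
    have sys: "vec_block M (poly_block_mat (E_mat r) cQ *\<^sub>v map_vec complex_of_real X) k =
        map_vec complex_of_real (b k)" if "k \<le> r" for k
      unfolding mapA[OF X(1)] X(2)
      using map_vec_vec_block[OF B_cl, of k complex_of_real] vec_block_block_vec[of b k M "r + 1"] b_cl[OF that] that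
      by (simp add: B)
    have eq: "map_vec complex_of_real (vec_block M X (i - 1)) = vec_block M (map_vec complex_of_real X) (i - 1)"
      by (rule map_vec_vec_block[OF X(1)]) (use i in auto)
    show ?thesis unfolding eq
    proof (rule partial_fraction_solution[OF cQ r zeros _ _ _ _ _ i,
          where b = "\<lambda>k. map_vec complex_of_real (b k)" and X = "map_vec complex_of_real X"])
      show "map_vec complex_of_real X \<in> carrier_vec ((r + 1) * M)" using X(1) by simp
      show "map_vec complex_of_real (b k) \<in> carrier_vec M" if "k \<le> r" for k
        using b_cl[OF that] by simp
    qed (fact part3 phi_inj sys)+
  qed
  show ?thesis
    using part1 part2 part3 part4 unfolding Q_def[symmetric] cQ_def[symmetric] by blast
qed

end
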